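(* Let $N\ge 1$ and let $\mathcal{L}=a^N(x)\frac{\mathrm{d}^N}{\mathrm{d}x^N}+\dots+a^1(x)\frac{\mathrm{d}}{\mathrm{d}x}+a^0(x)$ be an $N$th order linear differential operator on $[-1,1]$ with smooth variable coefficients $a^0,\dots,a^N$ (and $a^N(x)\neq 0$). For each $n\ge 1$ let $S_\lambda$ ($\lambda=0,\dots,N-1$) and $L$ be the $n\times n$ truncations, defined in the context, of the ultraspherical conversion operators and of the ultraspherical representation of $\mathcal{L}$; that is, the spatial semi-discretization of $u_t=\mathcal{L}u$ (boundary conditions left aside) is $S_{N-1}\cdots S_0\,\frac{\mathrm{d}}{\mathrm{d}t}u=Lu$ for the vector $u(t)\in\mathbb{R}^n$ of Chebyshev coefficients. Then there exists a constant $C$, independent of $n$, such that for all $n$ $$\rho\left(S_0^{-1}S_1^{-1}\cdots S_{N-1}^{-1}L\right)\le C n^{2N},$$ where $\rho$ denotes the spectral radius.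
   Context: Infinite matrices are indexed by $j,k\ge 0$. In the superscripts of $a^\lambda$, $\lambda$ is an index, not a power. "Smooth" means $C^\infty$ on $[-1,1]$. $T_k$ are the Chebyshev polynomials of the first kind; for $\lambda\ge1$, $C^{(\lambda)}_k$ are the ultraspherical (Gegenbauer) polynomials; by convention $C^{(0)}_k:=T_k$ here. Conversion operators: $\mathcal{S}_0$ has $(\mathcal{S}_0)_{0,0}=1$, $(\mathcal{S}_0)_{k,k}=\frac12$ for $k\ge1$, $(\mathcal{S}_0)_{k,k+2}=-\frac12$ for $k\ge0$, and zeros elsewhere. For $\lambda\ge1$, $(\mathcal{S}_\lambda)_{k,k}=\frac{\lambda}{\lambda+k}$, $(\mathcal{S}_\lambda)_{k,k+2}=-\frac{\lambda}{\lambda+k+2}$ for $k\ge 0$, and zeros elsewhere. ($\mathcal S_\lambda$ maps $C^{(\lambda)}$ coefficients to $C^{(\lambda+1)}$ coefficients.) Differentiation operators: $\mathcal{D}_0=\mathcal{I}$ (identity), and for $\lambda\ge1$, $(\mathcal{D}_\lambda)_{k,k+\lambda}=2^{\lambda-1}(\lambda-1)!\,(\lambda+k)$ for $k\ge0$, zeros elsewhere. ($\mathcal D_\lambda$ maps Chebyshev coefficients of $u$ to $C^{(\lambda)}$ coefficients of $u^{(\lambda)}$.) Multiplication operators: $\mathcal{M}_\lambda[a]$ is the infinite matrix representing multiplication by $a(x)$ on $C^{(\lambda)}$ coefficients: its $k$th column consists of the coefficients of the $C^{(\lambda)}$ expansion of $a(x)C^{(\lambda)}_k(x)$. The ultraspherical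 representation of $\mathcal{L}$, also denoted $\mathcal L$, is $$\mathcal{L}=\mathcal{M}_N[a^N]\mathcal{D}_N+\sum_{\lambda=0}^{N-1}\mathcal{S}_{N-1}\cdots\mathcal{S}_\lambda\,\mathcal{M}_\lambda[a^\lambda]\,\mathcal{D}_\lambda .$$ With $\mathcal{P}_n=(I_n,\mathbf{0})$, set $S_\lambda=\mathcal{P}_n\mathcal{S}_\lambda\mathcal{P}_n^{\top}$ and $L=\mathcal{P}_n\mathcal{L}\mathcal{P}_n^{\top}$ (exact truncation: the leading $n\times n$ section of the infinite matrix $\mathcal L$). *)

theory Defs
  imports "HOL-Analysis.Analysis" "Jordan_Normal_Form.Gauss_Jordan_Elimination"
    "Jordan_Normal_Form.Spectral_Radius"
begin

text \<open>\<open>C\<^sup>\<infinity>\<close> on the closed interval \<open>[-1,1]\<close>: derivatives of all orders exist there, one-sided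
  ones at the endpoints.\<close>

definition smooth_on_I :: "(real \<Rightarrow> real) \<Rightarrow> bool" where
  "smooth_on_I f \<longleftrightarrow> (\<exists>D :: nat \<Rightarrow> real \<Rightarrow> real. D 0 = f \<and>
     (\<forall>m. \<forall>x\<in>{-1..1}. (D m has_real_derivative D (Suc m) x) (at x within {-1..1})))"

fun cheb_T :: "nat \<Rightarrow> real \<Rightarrow> real" where
  "cheb_T 0 x = 1"
| "cheb_T (Suc 0) x = x"
| "cheb_T (Suc (Suc k)) x = 2 * x * cheb_T (Suc k) x - cheb_T k x"

fun gegenbauer :: "nat \<Rightarrow> nat \<Rightarrow> real \<Rightarrow> real" where
  "gegenbauer l 0 x = 1"
| "gegenbauer l (Suc 0) x = 2 * real l * x"
| "gegenbauer l (Suc (Suc k)) x =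
     (2 * (real k + 1 + real l) * x * gegenbauer l (Suc k) x
        - (real k + 2 * real l) * gegenbauer l k x) / (real k + 2)"

definition ultra :: "nat \<Rightarrow> nat \<Rightarrow> real \<Rightarrow> real" where
  "ultra l k = (if l = 0 then cheb_T k else gegenbauer l k)"

text \<open>Coefficients of the orthogonal expansion of \<open>f\<close> in the \<open>ultra l j\<close>, which are orthogonal on
  \<open>[-1,1]\<close> for the weight \<open>(1 - x\<^sup>2) powr (l - 1/2)\<close>.  For \<open>l = 0\<close> the weight is singular (but
  integrable) at the endpoints; the value \<open>0 powr (-1/2) = 0\<close> there is immaterial.\<close>

definition ultra_weight :: "nat \<Rightarrow> real \<Rightarrow> real" where
  "ultra_weight l x = (1 - x\<^sup>2) powr (real l - 1 / 2)"

definition ultra_coeff :: "nat \<Rightarrow> (real \<Rightarrow> real) \<Rightarrow> nat \<Rightarrow> real" where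
  "ultra_coeff l f j =
     integral {-1..1} (\<lambda>x. f x * ultra l j x * ultra_weight l x) /
     integral {-1..1} (\<lambda>x. (ultra l j x)\<^sup>2 * ultra_weight l x)"

type_synonym imat = "nat \<Rightarrow> nat \<Rightarrow> real"

text \<open>Every product formed below has, in each entry, only finitely many nonzero summands (see
  \<open>imult_conv_op\<close> and \<open>imult_diff_op\<close>), so no convergence question arises.\<close>

definition imult :: "imat \<Rightarrow> imat \<Rightarrow> imat" where
  "imult A B = (\<lambda>j k. \<Sum>i. A j i * B i k)"

definition conv_op :: "nat \<Rightarrow> imat" where
  "conv_op l = (\<lambda>j k.
     if l = 0 then
       (if k = j then (if j = 0 then 1 else 1 / 2)
        else if k = j + 2 then - 1 / 2 else 0)
     else
       (if k = j then real l / (real l + real j)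
        else if k = j + 2 then - real l / (real l + real j + 2) else 0))"

definition diff_op :: "nat \<Rightarrow> imat" where
  "diff_op l = (\<lambda>j k.
     if l = 0 then (if k = j then 1 else 0)
     else (if k = j + l then 2 ^ (l - 1) * fact (l - 1) * (real l + real j) else 0))"

definition mult_op :: "nat \<Rightarrow> (real \<Rightarrow> real) \<Rightarrow> imat" where
  "mult_op l f = (\<lambda>j k. ultra_coeff l (\<lambda>x. f x * ultra l k x) j)"

text \<open>The fold applies \<open>conv_op l\<close> first and \<open>conv_op (N - 1)\<close> last.\<close>

definition ultra_rep :: "nat \<Rightarrow> (nat \<Rightarrow> real \<Rightarrow> real) \<Rightarrow> imat" where
  "ultra_rep N a = (\<lambda>j k.
     imult (mult_op N (a N)) (diff_op N) j k +
     (\<Sum>l<N. foldr imult (map conv_op (rev [l..<N])) (imult (mult_op l (a l)) (diff_op l)) j k))"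

definition section_mat :: "nat \<Rightarrow> imat \<Rightarrow> real Matrix.mat" where
  "section_mat n A = Matrix.mat n n (\<lambda>(j, k). A j k)"

text \<open>\<open>the\<close> is harmless here: see \<open>conv_inv\<close>.\<close>

definition conv_inv_mat :: "nat \<Rightarrow> nat \<Rightarrow> real Matrix.mat" where
  "conv_inv_mat n l = the (mat_inverse (section_mat n (conv_op l)))"

text \<open>\<open>S\<^sub>0\<^sup>-\<^sup>1 S\<^sub>1\<^sup>-\<^sup>1 \<cdots> S\<^sub>N\<^sub>-\<^sub>1\<^sup>-\<^sup>1 L\<close> for the \<open>n \<times> n\<close> sections.\<close>

definition semidiscrete_mat :: "nat \<Rightarrow> nat \<Rightarrow> (nat \<Rightarrow> real \<Rightarrow> real) \<Rightarrow> real Matrix.mat" where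
  "semidiscrete_mat n N a =
     foldr (*) (map (conv_inv_mat n) [0..<N]) (section_mat n (ultra_rep N a))"

lemma imult_conv_op:
  "imult (conv_op l) A j k = conv_op l j j * A j k + conv_op l j (j + 2) * A (j + 2) k"
proof -
  have "(\<Sum>i. conv_op l j i * A i k) = (\<Sum>i\<in>{j, j + 2}. conv_op l j i * A i k)"
    by (rule suminf_finite) (auto simp: conv_op_def)
  then show ?thesis by (simp add: imult_def)
qed

lemma imult_diff_op:
  "imult A (diff_op l) j k = (if k < l then 0 else A j (k - l) * diff_op l (k - l) k)"
proof -
  have "(\<Sum>i. A j i * diff_op l i k) =
      (\<Sum>i\<in>(if k < l then {} else {k - l}). A j i * diff_op l i k)"
    by (rule suminf_finite) (auto simp: diff_op_def)
  then show ?thesis by (simp add: imult_def)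
qed

lemma conv_inv:
  "conv_inv_mat n l \<in> carrier_mat n n"
  "conv_inv_mat n l * section_mat n (conv_op l) = 1\<^sub>m n"
  "section_mat n (conv_op l) * conv_inv_mat n l = 1\<^sub>m n"
proof -
  let ?S = "section_mat n (conv_op l)"
  have S: "?S \<in> carrier_mat n n" by (simp add: section_mat_def)
  have "upper_triangular ?S"
    by (auto simp: upper_triangular_def section_mat_def conv_op_def)
  then have "Determinant.det ?S = prod_list (diag_mat ?S)"
    using S by (rule det_upper_triangular)
  also have "\<dots> \<noteq> 0"
    by (auto simp: prod_list_zero_iff diag_mat_def section_mat_def conv_op_def)
  finally have "?S \<in> Units (ring_mat TYPE(real) n ())"
    using S by (intro det_non_zero_imp_unit)
  then obtain B where "mat_inverse ?S = Some B"
    using mat_inverse(1)[OF S, where b = "()"] by (cases "mat_inverse ?S") blast+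
  with mat_inverse(2)[OF S this]
  show "conv_inv_mat n l \<in> carrier_mat n n" "conv_inv_mat n l * ?S = 1\<^sub>m n"
    "?S * conv_inv_mat n l = 1\<^sub>m n"
    by (auto simp: conv_inv_mat_def)
qed

end

theory Submission
  imports Defs
begin

text \<open>
  The matrix is a Galerkin matrix in disguise, and it is estimated by quadratic forms in the
  weighted spaces \<open>L\<^sup>2(w\<^sub>l)\<close>, where \<open>w\<^sub>l(x) = (1 - x\<^sup>2) powr (l - 1/2)\<close>.

  Identify \<open>v\<close> in \<open>\<real>\<^sup>n\<close> with the polynomial \<open>p = \<Sum>k<n. v\<^sub>k T\<^sub>k\<close>. Since the conversion operators are upper
  triangular, their sections convert the coefficients of a polynomial of degree below \<open>n\<close> exactly, and
  so do the inverses of the sections (\<open>vec_poly_conv_inv\<close>). On the other side, row \<open>j\<close> of the infinite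
  matrix of the operator, applied to \<open>v\<close>, is the \<open>j\<close>-th \<open>C^(N)\<close> coefficient of the function obtained by
  applying the operator to \<open>p\<close> (\<open>ultra_rep_eq\<close>): this only needs that \<open>conv_op l\<close> maps the \<open>C^(l)\<close>
  coefficients of an arbitrary continuous function to its \<open>C^(l+1)\<close> coefficients (\<open>ultra_coeff_Suc\<close>).
  Hence the semi-discrete matrix sends \<open>p\<close> to the \<open>L\<^sup>2(w\<^sub>N)\<close>-orthogonal projection of the image of \<open>p\<close> onto
  the polynomials of degree below \<open>n\<close> (\<open>semidiscrete_galerkin\<close>).

  An eigenvalue is therefore a Rayleigh quotient in \<open>L\<^sup>2(w\<^sub>N)\<close>, and it suffices to bound \<open>\<integral> a\<^sub>l p^(l) q w\<^sub>N\<close>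
  by the norms of \<open>p\<close> and \<open>q\<close> in \<open>L\<^sup>2(w\<^sub>N)\<close>. The coefficient functions are bounded on \<open>[-1,1]\<close>, and \<open>n^(2N)\<close> is
  made up of two factors \<open>n^N\<close>, each coming from an inequality for polynomials of degree below \<open>n\<close>.

  \<^item> Bernstein: \<open>\<parallel>p^(l)\<parallel>\<close> in \<open>L\<^sup>2(w\<^sub>l)\<close> is at most a constant times \<open>n^l \<parallel>p\<parallel>\<close> in \<open>L\<^sup>2(w\<^sub>0)\<close> (\<open>sum_deriv_bound\<close>);
    \<open>p^(l)\<close> expands in the orthogonal family \<open>C^(l)\<close> without mixing of terms, so only the norms of the
    basis polynomials have to be compared.

  \<^item> Schur: \<open>\<parallel>p\<parallel>\<close> in \<open>L\<^sup>2(w\<^sub>l)\<close> is at most \<open>2 n \<parallel>p\<parallel>\<close> in \<open>L\<^sup>2(w\<^sub>l\<^sub>+\<^sub>1)\<close> (\<open>conv_seq_inverse_bound\<close>); in coefficients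
    this says that inverting a conversion costs a factor \<open>n\<close>, which is seen by telescoping and the
    Cauchy-Schwarz inequality.

  Starting from the orthogonality of the cosines, everything about the polynomials that enters here
  follows from two identities that link the families for \<open>l\<close> and \<open>l + 1\<close>: \<open>ultra_conv\<close>, which expresses
  \<open>C^(l)\<close> through \<open>C^(l+1)\<close>, and \<open>ultra_weighted\<close>, which expresses \<open>(1 - x\<^sup>2) C^(l+1)\<close> through \<open>C^(l)\<close>.
\<close>

section \<open>Identities between neighbouring ultraspherical families\<close>

lemma gegenbauer_rec:
  "(real k + 2) * gegenbauer l (k + 2) x =
     2 * (real k + 1 + real l) * x * gegenbauer l (k + 1) x
     - (real k + 2 * real l) * gegenbauer l k x"
  by simp

lemma gegenbauer_0_1:
  "gegenbauer l 0 x = 1"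
  "gegenbauer l 1 x = 2 * real l * x"
  "gegenbauer l (Suc 0) x = 2 * real l * x"
  by simp_all

declare gegenbauer.simps [simp del]

lemma gegenbauer_2: "gegenbauer l 2 x = 2 * real l * (real l + 1) * x\<^sup>2 - real l"
  using gegenbauer_rec[of 0 l x] by (simp add: gegenbauer_0_1 power2_eq_square
      numeral_2_eq_2 [symmetric] algebra_simps)

lemma gegenbauer_3:
  "3 * gegenbauer l 3 x = 2 * (real l + 2) * x * gegenbauer l 2 x
      - (1 + 2 * real l) * (2 * real l * x)"
  using gegenbauer_rec[of 1 l x] by (simp add: gegenbauer_0_1 eval_nat_numeral algebra_simps)

text \<open>
  Both sides satisfy three-term recurrences, so the identity is propagated by two-step induction.
  The induction step eliminates all polynomials multiplied by \<open>x\<close> with the recurrences of the two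
  families.
\<close>
lemma gegenbauer_conv:
  assumes "l \<ge> 1"
  shows "(real k + 2 + real l) * gegenbauer l (k + 2) x =
           real l * (gegenbauer (Suc l) (k + 2) x - gegenbauer (Suc l) k x)"
proof (induction k rule: induct_nat_012)
  case 0
  show ?case by (simp add: gegenbauer_0_1 gegenbauer_2 numeral_2_eq_2 [symmetric] algebra_simps
      power2_eq_square)
next
  case 1
  define L where "L = real l"
  have "3 * ((3 + L) * gegenbauer l 3 x - L * (gegenbauer (Suc l) 3 x - 2 * (1 + L) * x)) =
    (3 + L) * (3 * gegenbauer l 3 x) - L * (3 * gegenbauer (Suc l) 3 x - 6 * (1 + L) * x)"
    by (simp add: algebra_simps)
  also have "\<dots> = 0"
    unfolding gegenbauer_3 gegenbauer_2 by (simp add: L_def algebra_simps power2_eq_square)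
  finally show ?case by (simp add: L_def gegenbauer_0_1 eval_nat_numeral algebra_simps)
next
  case (ge2 k)
  define m where "m = real k"
  define L where "L = real l"
  have pos: "m \<ge> 0" "L \<ge> 1" using assms by (auto simp: m_def L_def)
  define C where "C i = gegenbauer l (k + i) x" for i
  define D where "D i = gegenbauer (Suc l) (k + i) x" for i
  have a: "(m + 4) * C 4 = 2 * (m + 3 + L) * x * C 3 - (m + 2 + 2 * L) * C 2"
    using gegenbauer_rec[of "k + 2" l x] by (simp add: C_def m_def L_def eval_nat_numeral
        algebra_simps)
  have b: "(m + 4) * D 4 = 2 * (m + 4 + L) * x * D 3 - (m + 4 + 2 * L) * D 2"
    using gegenbauer_rec[of "k + 2" "Suc l" x]
    by (simp add: D_def m_def L_def eval_nat_numeral algebra_simps)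
  have c: "(m + 2) * D 2 = 2 * (m + 2 + L) * x * D 1 - (m + 2 + 2 * L) * D 0"
    using gegenbauer_rec[of "k" "Suc l" x] by (simp add: D_def m_def L_def eval_nat_numeral
        algebra_simps)
  have d: "(m + 2 + L) * C 2 = L * (D 2 - D 0)" "(m + 3 + L) * C 3 = L * (D 3 - D 1)"
    using ge2 by (simp_all add: C_def D_def m_def L_def eval_nat_numeral algebra_simps)
  have "(m + 4) * (m + 2 + L) * ((m + 4 + L) * C 4 - L * (D 4 - D 2)) = 0" (is "?E = 0")
  proof -
    \<comment> \<open>A combination of the five recurrences and induction hypotheses, each written as a difference.\<close>
    have "?E = (m + 2 + L) * (m + 4 + L) * ((m + 4) * C 4
        - (2 * (m + 3 + L) * x * C 3 - (m + 2 + 2 * L) * C 2))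
        - L * (m + 2 + L) * ((m + 4) * D 4 - (2 * (m + 4 + L) * x * D 3 - (m + 4 + 2 * L) * D 2))
        + 2 * (m + 2 + L) * (m + 4 + L) * x * ((m + 3 + L) * C 3 - L * (D 3 - D 1))
        - (m + 4 + L) * (m + 2 + 2 * L) * ((m + 2 + L) * C 2 - L * (D 2 - D 0))
        + L * (m + 4 + L) * ((m + 2) * D 2 - (2 * (m + 2 + L) * x * D 1 - (m + 2 + 2 * L) * D 0))"
      by (simp add: algebra_simps power2_eq_square)
    then show ?thesis unfolding a b c d by simp
  qed
  then have "(m + 4 + L) * C 4 = L * (D 4 - D 2)" using pos by simp
  then show ?case by (simp add: C_def D_def m_def L_def eval_nat_numeral algebra_simps)
qed

text \<open>
  Proved in the same way, with the recurrence for \<open>gegenbauer (Suc l)\<close> multiplied by \<open>1 - x\<^sup>2\<close>.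
\<close>
lemma gegenbauer_weight:
  assumes "l \<ge> 1"
  shows "4 * real l * (real j + real l + 1) * ((1 - x\<^sup>2) * gegenbauer (Suc l) j x) =
     (real j + 2 * real l) * (real j + 2 * real l + 1) * gegenbauer l j x
     - (real j + 1) * (real j + 2) * gegenbauer l (j + 2) x"
proof (induction j rule: induct_nat_012)
  case 0
  show ?case by (simp add: gegenbauer_0_1 gegenbauer_2 numeral_2_eq_2 [symmetric] algebra_simps
      power2_eq_square)
next
  case 1
  show ?case using gegenbauer_3[of l x] unfolding gegenbauer_2
    by (simp add: gegenbauer_0_1 eval_nat_numeral algebra_simps power2_eq_square)
next
  case (ge2 k)
  define m where "m = real k"
  define L where "L = real l"
  have pos: "m \<ge> 0" "L \<ge> 1" using assms by (auto simp: m_def L_def)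
  define C where "C i = gegenbauer l (k + i) x" for i
  define G where "G i = (1 - x\<^sup>2) * gegenbauer (Suc l) (k + i) x" for i
  have a: "(m + 2) * G 2 = 2 * (m + 2 + L) * x * G 1 - (m + 2 + 2 * L) * G 0"
    proof -
    have "(m + 2) * G 2 = (1 - x\<^sup>2) * ((real k + 2) * gegenbauer (Suc l) (k + 2) x)"
      by (simp add: G_def m_def)
    then show ?thesis
      unfolding gegenbauer_rec by (simp add: G_def m_def L_def algebra_simps)
  qed
  have b: "(m + 4) * C 4 = 2 * (m + 3 + L) * x * C 3 - (m + 2 + 2 * L) * C 2"
    using gegenbauer_rec[of "k + 2" l x] by (simp add: C_def m_def L_def eval_nat_numeral
        algebra_simps)
  have c: "(m + 2) * C 2 = 2 * (m + 1 + L) * x * C 1 - (m + 2 * L) * C 0"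
    using gegenbauer_rec[of "k" l x] by (simp add: C_def m_def L_def eval_nat_numeral algebra_simps)
  have d: "4 * L * (m + L + 1) * G 0 = (m + 2 * L) * (m + 2 * L + 1) * C 0 - (m + 1) * (m + 2) * C 2"
     "4 * L * (m + 1 + L + 1) * G 1 = (m + 1 + 2 * L) * (m + 1 + 2 * L + 1) * C 1
         - (m + 2) * (m + 3) * C 3"
    using ge2 by (simp_all add: C_def G_def m_def L_def eval_nat_numeral algebra_simps)
  have "(m + 2) * (m + L + 1) * (4 * L * (m + 2 + L + 1) * G 2
      - ((m + 2 + 2 * L) * (m + 2 + 2 * L + 1) * C 2 - (m + 3) * (m + 4) * C 4)) = 0" (is "?E = 0")
  proof -
    \<comment> \<open>Again a combination of the recurrences and the induction hypotheses.\<close>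
    have "?E = 4 * L * (m + L + 1) * (m + 3 + L) * ((m + 2) * G 2
        - (2 * (m + 2 + L) * x * G 1 - (m + 2 + 2 * L) * G 0))
        + 2 * x * (m + L + 1) * (m + 3 + L) * (4 * L * (m + 1 + L + 1) * G 1
            - ((m + 1 + 2 * L) * (m + 1 + 2 * L + 1) * C 1 - (m + 2) * (m + 3) * C 3))
        - (m + 3 + L) * (m + 2 + 2 * L) * (4 * L * (m + L + 1) * G 0
            - ((m + 2 * L) * (m + 2 * L + 1) * C 0 - (m + 1) * (m + 2) * C 2))
        + (m + L + 1) * (m + 2) * (m + 3) * ((m + 4) * C 4
            - (2 * (m + 3 + L) * x * C 3 - (m + 2 + 2 * L) * C 2))
        - (m + 3 + L) * (m + 1 + 2 * L) * (m + 2 + 2 * L) * ((m + 2) * C 2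
            - (2 * (m + 1 + L) * x * C 1 - (m + 2 * L) * C 0))"
      by (simp add: algebra_simps power2_eq_square)
    then show ?thesis unfolding a b c d by simp
  qed
  then have "4 * L * (m + 2 + L + 1) * G 2 = (m + 2 + 2 * L) * (m + 2 + 2 * L + 1) * C 2
      - (m + 3) * (m + 4) * C 4" using pos by simp
  then show ?case by (simp add: C_def G_def m_def L_def eval_nat_numeral algebra_simps)
qed

lemma gegenbauer_1_rec:
  "gegenbauer 1 (k + 2) x = 2 * x * gegenbauer 1 (k + 1) x - gegenbauer 1 k x"
proof -
  have "(real k + 2) * gegenbauer 1 (k + 2) x =
      (real k + 2) * (2 * x * gegenbauer 1 (k + 1) x - gegenbauer 1 k x)"
    using gegenbauer_rec[of k 1 x] by (simp add: algebra_simps)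
  then show ?thesis by (simp del: One_nat_def)
qed

lemma cheb_conv: "2 * cheb_T (k + 2) x = gegenbauer 1 (k + 2) x - gegenbauer 1 k x"
proof (induction k rule: induct_nat_012)
  case 0
  show ?case using gegenbauer_2[of 1 x] by (simp add: gegenbauer_0_1 numeral_2_eq_2 power2_eq_square)
next
  case 1
  show ?case using gegenbauer_3[of 1 x] unfolding gegenbauer_2
    by (simp add: gegenbauer_0_1 eval_nat_numeral algebra_simps)
next
  case (ge2 k)
  define G where "G i = gegenbauer 1 (k + i) x" for i
  define T where "T i = cheb_T (k + i) x" for i
  have T: "2 * T 2 = G 2 - G 0" "2 * T 3 = G 3 - G 1"
    using ge2 by (simp_all add: G_def T_def eval_nat_numeral del: cheb_T.simps)
  have G: "G 2 = 2 * x * G 1 - G 0" "G 4 = 2 * x * G 3 - G 2"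
    using gegenbauer_1_rec[of k x] gegenbauer_1_rec[of "k + 2" x]
    by (simp_all add: G_def eval_nat_numeral)
  have "2 * T 4 = 2 * x * (2 * T 3) - 2 * T 2"
    by (simp add: T_def eval_nat_numeral)
  also have "\<dots> = G 4 - G 2"
    unfolding T G by (simp add: algebra_simps)
  finally show ?case by (simp add: G_def T_def eval_nat_numeral del: cheb_T.simps)
qed

lemma cheb_weight: "2 * ((1 - x\<^sup>2) * gegenbauer 1 j x) = cheb_T j x - cheb_T (j + 2) x"
proof (induction j rule: induct_nat_012)
  case (ge2 k)
  define G where "G i = gegenbauer 1 (k + i) x" for i
  define T where "T i = cheb_T (k + i) x" for i
  have G: "2 * ((1 - x\<^sup>2) * G 0) = T 0 - T 2" "2 * ((1 - x\<^sup>2) * G 1) = T 1 - T 3"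
    using ge2 by (simp_all add: G_def T_def eval_nat_numeral del: cheb_T.simps)
  have "2 * ((1 - x\<^sup>2) * G 2) = 2 * x * (2 * ((1 - x\<^sup>2) * G 1)) - 2 * ((1 - x\<^sup>2) * G 0)"
    unfolding G_def gegenbauer_1_rec by (simp add: algebra_simps)
  also have "\<dots> = (2 * x * T 1 - T 0) - (2 * x * T 3 - T 2)"
    unfolding G by (simp add: algebra_simps)
  also have "\<dots> = T 2 - T 4"
    by (simp add: T_def eval_nat_numeral)
  finally show ?case by (simp add: G_def T_def eval_nat_numeral del: cheb_T.simps)
qed (simp_all add: gegenbauer_0_1 eval_nat_numeral algebra_simps)

section \<open>The weighted integral\<close>

text \<open>
  The integral against \<open>ultra_weight l\<close> after the substitution \<open>x = cos t\<close>: the integrand becomes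
  continuous for every \<open>l\<close>, also for \<open>l = 0\<close>, where the weight in \<open>x\<close> is unbounded.
\<close>
definition ultra_int :: "nat \<Rightarrow> (real \<Rightarrow> real) \<Rightarrow> real" where
  "ultra_int l f = integral {0..pi} (\<lambda>t. f (cos t) * sin t ^ (2 * l))"

lemma cont_ultra_integrand:
  assumes "continuous_on {-1..1} f"
  shows "continuous_on {0..pi} (\<lambda>t. f (cos t) * sin t ^ (2 * l))"
  by (intro continuous_intros continuous_on_compose2[OF assms]) auto

lemma integrable_ultra_integrand:
  assumes "continuous_on {-1..1} f"
  shows "(\<lambda>t. f (cos t) * sin t ^ (2 * l)) integrable_on {0..pi}"
  by (intro integrable_continuous_real cont_ultra_integrand assms)

text \<open>
  Substitution of \<open>arccos\<close>, whose derivative blows up at the two endpoints; these are the exceptional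
  points allowed by the substitution rule.
\<close>
lemma integral_ultra_weight:
  assumes f: "continuous_on {-1..1} f"
  shows "integral {-1..1} (\<lambda>x. f x * ultra_weight l x) = ultra_int l f"
proof -
  let ?F = "\<lambda>t. f (cos t) * sin t ^ (2 * l)"
  have "((\<lambda>x. (- inverse (sqrt (1 - x\<^sup>2))) *\<^sub>R ?F (arccos x)) has_integral
      (integral {arccos (-1)..arccos 1} ?F - integral {arccos 1..arccos (-1)} ?F)) {-1..1}"
  proof (rule has_integral_substitution_general[where s = "{-1, 1}" and c = 0 and d = pi])
    show "arccos ` {- 1..1} \<subseteq> {0..pi}" using arccos_lbound arccos_ubound by auto
    show "continuous_on {0..pi} ?F" using f by (rule cont_ultra_integrand)
    show "continuous_on {- 1..1} arccos" by (rule continuous_on_arccos')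
    fix x :: real assume "x \<in> {- 1..1} - {- 1, 1}"
    then show "(arccos has_real_derivative - inverse (sqrt (1 - x\<^sup>2))) (at x within {- 1..1})"
      using has_field_derivative_at_within[OF DERIV_arccos[of x]] by (simp add: less_le)
  qed auto
  then have "((\<lambda>x. (- inverse (sqrt (1 - x\<^sup>2))) *\<^sub>R ?F (arccos x)) has_integral
      - ultra_int l f) {-1..1}"
    by (simp add: ultra_int_def)
  from has_integral_neg[OF this]
  have "((\<lambda>x. - ((- inverse (sqrt (1 - x\<^sup>2))) *\<^sub>R ?F (arccos x))) has_integral ultra_int l f) {-1..1}"
    by (simp only: minus_minus)
  \<comment> \<open>At the endpoints both sides vanish: \<open>inverse 0 = 0\<close>, and \<open>0 powr a = 0\<close> in the weight.\<close>
  moreover have "- ((- inverse (sqrt (1 - x\<^sup>2))) *\<^sub>R ?F (arccos x)) = f x * ultra_weight l x"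
    if "x \<in> {-1..1}" for x
  proof (cases "x\<^sup>2 = 1")
    case True
    then show ?thesis by (simp add: ultra_weight_def)
  next
    case False
    with that have "x\<^sup>2 < 1" by (metis abs_square_le_1 abs_le_iff atLeastAtMost_iff less_eq_real_def
        minus_le_iff)
    then have *: "1 - x\<^sup>2 > 0" by simp
    have W: "(1 - x\<^sup>2) powr (real l - 1 / 2) = (1 - x\<^sup>2) ^ l / sqrt (1 - x\<^sup>2)"
      unfolding powr_diff powr_realpow[OF *] powr_half_sqrt[OF less_imp_le[OF *]] ..
    have S: "sin (arccos x) ^ (2 * l) = (1 - x\<^sup>2) ^ l"
      using that * by (simp add: sin_arccos power_mult)
    have "cos (arccos x) = x" using that by simp
    then show ?thesis unfolding ultra_weight_def W S by (simp add: divide_inverse)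
  qed
  ultimately have "((\<lambda>x. f x * ultra_weight l x) has_integral ultra_int l f) {-1..1}"
    by (rule has_integral_eq [rotated]) blast
  then show ?thesis by (rule integral_unique)
qed

lemma ultra_int_add:
  assumes "continuous_on {-1..1} f" "continuous_on {-1..1} g"
  shows "ultra_int l (\<lambda>x. f x + g x) = ultra_int l f + ultra_int l g"
  unfolding ultra_int_def distrib_right
  by (intro integral_add integrable_ultra_integrand assms)

lemma ultra_int_cmult: "ultra_int l (\<lambda>x. c * f x) = c * ultra_int l f"
  unfolding ultra_int_def mult.assoc by simp

lemma ultra_int_sum:
  assumes "finite A" "\<And>i. i \<in> A \<Longrightarrow> continuous_on {-1..1} (f i)"
  shows "ultra_int l (\<lambda>x. \<Sum>i\<in>A. f i x) = (\<Sum>i\<in>A. ultra_int l (f i))"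
  unfolding ultra_int_def sum_distrib_right
  by (intro integral_sum integrable_ultra_integrand assms)

lemma ultra_int_mono:
  assumes "continuous_on {-1..1} f" "continuous_on {-1..1} g"
    and "\<And>x. x \<in> {-1..1} \<Longrightarrow> f x \<le> g x"
  shows "ultra_int l f \<le> ultra_int l g"
  unfolding ultra_int_def
  by (intro integral_le integrable_ultra_integrand assms mult_right_mono) auto

lemma ultra_int_nonneg:
  assumes "continuous_on {-1..1} f" "\<And>x. x \<in> {-1..1} \<Longrightarrow> 0 \<le> f x"
  shows "0 \<le> ultra_int l f"
  unfolding ultra_int_def
  by (intro integral_nonneg integrable_ultra_integrand assms) (use assms in auto)

lemma ultra_int_weight_mono:
  assumes "m \<le> l" "continuous_on {-1..1} f" "\<And>x. x \<in> {-1..1} \<Longrightarrow> 0 \<le> f x"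
  shows "ultra_int l f \<le> ultra_int m f"
  unfolding ultra_int_def
proof (intro integral_le integrable_ultra_integrand assms)
  fix t :: real assume "t \<in> {0..pi}"
  then have "sin t ^ (2 * l) \<le> sin t ^ (2 * m)"
    using assms(1) by (intro power_decreasing) (auto intro: sin_ge_zero)
  then show "f (cos t) * sin t ^ (2 * l) \<le> f (cos t) * sin t ^ (2 * m)"
    using assms(3) by (intro mult_left_mono) auto
qed

lemma ultra_int_Suc: "ultra_int (Suc l) f = ultra_int l (\<lambda>x. f x * (1 - x\<^sup>2))"
proof -
  have "sin t ^ (2 * Suc l) = (1 - (cos t)\<^sup>2) * sin t ^ (2 * l)" for t :: real
    unfolding sin_squared_eq [symmetric] by (simp add: power2_eq_square)
  then show ?thesis unfolding ultra_int_def mult.assoc by metis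
qed

lemma continuous_ultra [continuous_intros]: "continuous_on A (ultra l k)"
proof -
  have "continuous_on A (cheb_T k)"
    by (induction k rule: induct_nat_012) (auto intro!: continuous_intros)
  moreover have "continuous_on A (gegenbauer l k)"
    by (induction k rule: induct_nat_012) (auto simp: gegenbauer.simps intro!: continuous_intros)
  ultimately show ?thesis by (auto simp: ultra_def)
qed

section \<open>Conversion and weighting\<close>

text \<open>
  By \<open>conv_op_band\<close> the diagonal determines the whole matrix: \<open>conv_op l\<close> is the identity minus the
  shift by two, times the diagonal matrix of the \<open>conv_diag l\<close>.
\<close>
abbreviation conv_diag :: "nat \<Rightarrow> nat \<Rightarrow> real" where
  "conv_diag l k \<equiv> conv_op l k k"

lemma conv_diag_pos: "conv_diag l k > 0"
  by (auto simp: conv_op_def intro!: divide_pos_pos)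

lemma conv_op_band:
  "conv_op l j k = (if k = j then conv_diag l j else if k = j + 2 then - conv_diag l (j + 2) else 0)"
  by (auto simp: conv_op_def)

lemma ultra_conv:
  "ultra l k x = conv_diag l k * (ultra (Suc l) k x - (if k < 2 then 0 else ultra (Suc l) (k - 2) x))"
proof (cases "k < 2")
  case True
  then have "k = 0 \<or> k = 1" by auto
  then show ?thesis by (auto simp: ultra_def conv_op_def gegenbauer_0_1 field_simps)
next
  case False
  then obtain m where k: "k = m + 2" using le_Suc_ex[of 2 k] by auto
  show ?thesis
  proof (cases "l = 0")
    case True
    then show ?thesis using cheb_conv[of m x] by (simp add: k ultra_def conv_op_def del: cheb_T.simps)
  next
    case l: False
    have "real m + 2 + real l > 0" by simp
    with gegenbauer_conv[of l m x] l show ?thesis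
      by (simp add: k ultra_def conv_op_def field_simps)
  qed
qed

text \<open>
  The coefficients of \<open>ultra l j\<close> and (up to sign) \<open>ultra l (j + 2)\<close> in the expansion of
  \<open>(1 - x\<^sup>2) * ultra (Suc l) j x\<close>, see \<open>ultra_weighted\<close>.
\<close>
definition weight_lo :: "nat \<Rightarrow> nat \<Rightarrow> real" where
  "weight_lo l j = (if l = 0 then 1 / 2 else
     (real j + 2 * real l) * (real j + 2 * real l + 1) / (4 * real l * (real j + real l + 1)))"

definition weight_hi :: "nat \<Rightarrow> nat \<Rightarrow> real" where
  "weight_hi l j = (if l = 0 then 1 / 2 else
     (real j + 1) * (real j + 2) / (4 * real l * (real j + real l + 1)))"

lemma weight_lo_pos: "weight_lo l j > 0"
  by (auto simp: weight_lo_def intro!: divide_pos_pos mult_pos_pos add_nonneg_pos)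

lemma weight_hi_pos: "weight_hi l j > 0"
  by (auto simp: weight_hi_def intro!: divide_pos_pos mult_pos_pos add_nonneg_pos)

lemma ultra_weighted:
  "(1 - x\<^sup>2) * ultra (Suc l) j x = weight_lo l j * ultra l j x - weight_hi l j * ultra l (j + 2) x"
proof (cases "l = 0")
  case True
  then show ?thesis using cheb_weight[of x j]
    by (simp add: ultra_def weight_lo_def weight_hi_def del: cheb_T.simps)
next
  case False
  define d where "d = 4 * real l * (real j + real l + 1)"
  have "d > 0" using False by (simp add: d_def)
  have "d * ((1 - x\<^sup>2) * ultra (Suc l) j x) = d * (weight_lo l j * ultra l j x
      - weight_hi l j * ultra l (j + 2) x)"
    using gegenbauer_weight[of l j x] False \<open>d > 0\<close>
    unfolding ultra_def weight_lo_def weight_hi_def d_def[symmetric]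
    by (simp add: right_diff_distrib)
  then show ?thesis using \<open>d > 0\<close> by simp
qed

section \<open>Orthogonality and norms\<close>

lemma continuous_ultra_fun [continuous_intros]:
  "continuous_on A f \<Longrightarrow> continuous_on A (\<lambda>x. ultra l k (f x))"
  using continuous_on_compose2[OF continuous_ultra[of UNIV]] by blast

lemma ultra_int_lincomb:
  assumes "continuous_on {-1..1} f" "continuous_on {-1..1} g"
  shows "ultra_int l (\<lambda>x. a * f x + b * g x) = a * ultra_int l f + b * ultra_int l g"
  using assms by (simp add: ultra_int_add ultra_int_cmult continuous_on_mult_left)

lemma ultra_0_cos: "ultra 0 k (cos t) = cos (real k * t)"
proof -
  have "cheb_T k (cos t) = cos (real k * t)"
  proof (induction k "cos t" rule: cheb_T.induct)
    case (3 k)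
    have "cos (real (Suc (Suc k)) * t) + cos (real k * t) = 2 * cos t * cos (real (Suc k) * t)"
      using cos_plus_cos[of "real (Suc (Suc k)) * t" "real k * t"]
      by (simp add: algebra_simps add_divide_distrib)
    with 3 show ?case by simp
  qed auto
  then show ?thesis by (simp add: ultra_def)
qed

lemma integral_cos_mult:
  fixes m :: real assumes "sin (m * pi) = 0" "m \<noteq> 0"
  shows "((\<lambda>t. cos (m * t)) has_integral 0) {0..pi}"
proof -
  have "((\<lambda>t. cos (m * t)) has_integral (sin (m * pi) / m - sin (m * 0) / m)) {0..pi}"
    using assms(2)
    by (intro fundamental_theorem_of_calculus)
       (auto intro!: derivative_eq_intros simp flip: has_real_derivative_iff_has_vector_derivative)
  then show ?thesis using assms(1) by simp
qed

lemma ultra_0_orthogonal: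
  assumes "i \<noteq> j"
  shows "ultra_int 0 (\<lambda>x. ultra 0 j x * ultra 0 i x) = 0"
proof -
  have s: "sin ((real j - real i) * pi) = 0" "sin ((real j + real i) * pi) = 0"
    by (simp_all add: sin_diff sin_add left_diff_distrib distrib_right)
  have "((\<lambda>t. 1 / 2 * (cos ((real j - real i) * t) + cos ((real j + real i) * t))) has_integral
      1 / 2 * (0 + 0)) {0..pi}"
    using assms s by (intro has_integral_mult_right has_integral_add integral_cos_mult) auto
  moreover have "1 / 2 * (cos ((real j - real i) * t) + cos ((real j + real i) * t))
      = cos (real j * t) * cos (real i * t)" for t
    by (simp add: left_diff_distrib distrib_right cos_diff cos_add)
  ultimately show ?thesis
    by (simp add: ultra_int_def ultra_0_cos integral_unique)
qed

text \<open>
  Induction on \<open>l\<close>. Since the weight for \<open>l + 1\<close> is \<open>1 - x\<^sup>2\<close> times the weight for \<open>l\<close>, the identity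
  \<open>ultra_weighted\<close> turns \<open>ultra (Suc l) j\<close> into a combination of \<open>ultra l j\<close> and \<open>ultra l (j + 2)\<close>,
  integrated against the weight for \<open>l\<close>. Both are orthogonal to \<open>ultra (Suc l) i\<close>, which by repeated use
  of \<open>ultra_conv\<close> is a combination of \<open>ultra l i\<close>, \<open>ultra l (i - 2)\<close>, and so on.
\<close>
lemma ultra_orthogonal_less:
  "i < j \<Longrightarrow> ultra_int l (\<lambda>x. ultra l j x * ultra l i x) = 0"
proof (induction l arbitrary: i j)
  case 0
  then show ?case by (intro ultra_0_orthogonal) auto
next
  case (Suc l)
  have cross: "ultra_int l (\<lambda>x. ultra l m x * ultra (Suc l) i x) = 0" if "i < m" for i m
    using that
  proof (induction i rule: less_induct)
    case (less i)
    let ?s = "conv_diag l i"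
    have s: "?s > 0" by (rule conv_diag_pos)
    show ?case
    proof (cases "i < 2")
      case True
      have "ultra (Suc l) i x = ultra l i x / ?s" for x
        using ultra_conv[of l i x] s True by (simp add: field_simps)
      then have "ultra_int l (\<lambda>x. ultra l m x * ultra (Suc l) i x)
          = ultra_int l (\<lambda>x. 1 / ?s * (ultra l m x * ultra l i x))"
        by simp
      then show ?thesis using Suc.IH[OF less.prems] by (simp only: ultra_int_cmult)
    next
      case False
      have "ultra (Suc l) i x = ultra l i x / ?s + ultra (Suc l) (i - 2) x" for x
        using ultra_conv[of l i x] s False by (simp add: field_simps)
      then have "ultra_int l (\<lambda>x. ultra l m x * ultra (Suc l) i x) =
          ultra_int l (\<lambda>x. 1 / ?s * (ultra l m x * ultra l i x)
              + 1 * (ultra l m x * ultra (Suc l) (i - 2) x))"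
        by (simp add: algebra_simps)
      also have "\<dots> = 1 / ?s * ultra_int l (\<lambda>x. ultra l m x * ultra l i x)
          + 1 * ultra_int l (\<lambda>x. ultra l m x * ultra (Suc l) (i - 2) x)"
        by (intro ultra_int_lincomb continuous_intros)
      finally show ?thesis using Suc.IH[OF less.prems] less.IH[of "i - 2"] less.prems False by simp
    qed
  qed
  have "ultra_int (Suc l) (\<lambda>x. ultra (Suc l) j x * ultra (Suc l) i x) =
      ultra_int l (\<lambda>x. ((1 - x\<^sup>2) * ultra (Suc l) j x) * ultra (Suc l) i x)"
    by (simp add: ultra_int_Suc mult_ac)
  also have "\<dots> = ultra_int l (\<lambda>x. weight_lo l j * (ultra l j x * ultra (Suc l) i x)
      + (- weight_hi l j) * (ultra l (j + 2) x * ultra (Suc l) i x))"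
    unfolding ultra_weighted by (simp add: algebra_simps)
  also have "\<dots> = weight_lo l j * ultra_int l (\<lambda>x. ultra l j x * ultra (Suc l) i x)
      + (- weight_hi l j) * ultra_int l (\<lambda>x. ultra l (j + 2) x * ultra (Suc l) i x)"
    by (intro ultra_int_lincomb continuous_intros)
  also have "\<dots> = 0" using Suc.prems by (simp add: cross)
  finally show ?case .
qed

lemma ultra_orthogonal:
  assumes "i \<noteq> j"
  shows "ultra_int l (\<lambda>x. ultra l j x * ultra l i x) = 0"
  using assms ultra_orthogonal_less[of i j l] ultra_orthogonal_less[of j i l]
  by (cases "i < j") (auto simp: mult.commute)

definition ultra_norm2 :: "nat \<Rightarrow> nat \<Rightarrow> real" where
  "ultra_norm2 l k = ultra_int l (\<lambda>x. (ultra l k x)\<^sup>2)"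

lemma ultra_int_Suc_ultra:
  assumes "continuous_on {-1..1} f"
  shows "ultra_int (Suc l) (\<lambda>x. f x * ultra (Suc l) j x) =
     weight_lo l j * ultra_int l (\<lambda>x. f x * ultra l j x)
         - weight_hi l j * ultra_int l (\<lambda>x. f x * ultra l (j + 2) x)"
proof -
  have "ultra_int (Suc l) (\<lambda>x. f x * ultra (Suc l) j x) =
      ultra_int l (\<lambda>x. f x * ((1 - x\<^sup>2) * ultra (Suc l) j x))"
    by (simp add: ultra_int_Suc mult_ac)
  also have "\<dots> = ultra_int l (\<lambda>x. weight_lo l j * (f x * ultra l j x)
      + (- weight_hi l j) * (f x * ultra l (j + 2) x))"
    unfolding ultra_weighted by (simp add: algebra_simps)
  also have "\<dots> = weight_lo l j * ultra_int l (\<lambda>x. f x * ultra l j x)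
      + (- weight_hi l j) * ultra_int l (\<lambda>x. f x * ultra l (j + 2) x)"
    by (intro ultra_int_lincomb continuous_intros assms)
  finally show ?thesis by simp
qed

text \<open>
  Evaluated once through \<open>ultra_conv\<close>, as here, and once through \<open>ultra_int_Suc_ultra\<close>, these integrals
  yield the two relations between norms below.
\<close>
lemma ultra_int_mixed:
  "ultra_int (Suc l) (\<lambda>x. ultra l k x * ultra (Suc l) j x) =
     conv_diag l k * (if j = k then ultra_norm2 (Suc l) k
       else if k = j + 2 then - ultra_norm2 (Suc l) j else 0)"
proof (cases "k < 2")
  case True
  have "ultra_int (Suc l) (\<lambda>x. ultra l k x * ultra (Suc l) j x) =
      ultra_int (Suc l) (\<lambda>x. conv_diag l k * (ultra (Suc l) k x * ultra (Suc l) j x))"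
    using True by (subst ultra_conv) (simp add: mult.assoc)
  then show ?thesis using True by (auto simp: ultra_int_cmult ultra_norm2_def power2_eq_square
      ultra_orthogonal)
next
  case False
  have "ultra_int (Suc l) (\<lambda>x. ultra l k x * ultra (Suc l) j x) =
      ultra_int (Suc l) (\<lambda>x. conv_diag l k * (ultra (Suc l) k x * ultra (Suc l) j x)
          + (- conv_diag l k) * (ultra (Suc l) (k - 2) x * ultra (Suc l) j x))"
    using False by (subst ultra_conv) (simp add: algebra_simps)
  also have "\<dots> = conv_diag l k * ultra_int (Suc l) (\<lambda>x. ultra (Suc l) k x * ultra (Suc l) j x)
      + (- conv_diag l k) * ultra_int (Suc l) (\<lambda>x. ultra (Suc l) (k - 2) x * ultra (Suc l) j x)"
    by (intro ultra_int_lincomb continuous_intros)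
  finally show ?thesis using False
    by (auto simp: ultra_norm2_def power2_eq_square ultra_orthogonal)
qed

lemma ultra_norm2_Suc_lo: "conv_diag l j * ultra_norm2 (Suc l) j = weight_lo l j * ultra_norm2 l j"
  using ultra_int_Suc_ultra[of "ultra l j" l j] ultra_int_mixed[of l j j]
  by (simp add: continuous_ultra ultra_orthogonal ultra_norm2_def power2_eq_square)

lemma ultra_norm2_Suc_hi: "conv_diag l (j + 2) * ultra_norm2 (Suc l) j
    = weight_hi l j * ultra_norm2 l (j + 2)"
  using ultra_int_Suc_ultra[of "ultra l (j + 2)" l j] ultra_int_mixed[of l "j + 2" j]
  by (simp add: continuous_ultra ultra_orthogonal ultra_norm2_def power2_eq_square)

lemma ultra_norm2_0: "ultra_norm2 0 k = (if k = 0 then pi else pi / 2)"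
proof (cases "k = 0")
  case True
  then show ?thesis by (simp add: ultra_norm2_def ultra_int_def ultra_0_cos)
next
  case False
  have s: "sin (2 * real k * pi) = 0"
    using sin_npi[of "2 * k"] by simp
  have "((\<lambda>t. 1 / 2 * (1 + cos (2 * real k * t))) has_integral 1 / 2 * (pi + 0)) {0..pi}"
    using False s has_integral_const_real[of "1::real" 0 pi]
    by (intro has_integral_mult_right has_integral_add integral_cos_mult) auto
  moreover have "1 / 2 * (1 + cos (2 * real k * t)) = (cos (real k * t))\<^sup>2" for t
    using cos_double_cos[of "real k * t"] by (simp add: algebra_simps)
  ultimately show ?thesis using False
    by (simp add: ultra_norm2_def ultra_int_def ultra_0_cos integral_unique)
qed

lemma ultra_norm2_pos: "ultra_norm2 l k > 0"
proof (induction l)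
  case 0
  show ?case by (simp add: ultra_norm2_0)
next
  case (Suc l)
  have "ultra_norm2 (Suc l) k = weight_lo l k * ultra_norm2 l k / conv_diag l k"
    using ultra_norm2_Suc_lo[of l k] conv_diag_pos[of l k] by (simp add: field_simps)
  then show ?case using Suc weight_lo_pos conv_diag_pos by simp
qed

lemma ultra_coeff_eq:
  assumes "continuous_on {-1..1} f"
  shows "ultra_coeff l f j = ultra_int l (\<lambda>x. f x * ultra l j x) / ultra_norm2 l j"
  unfolding ultra_coeff_def ultra_norm2_def using assms
  by (simp add: integral_ultra_weight continuous_intros)

text \<open>
  The conversion operator acts correctly on the coefficients of every continuous function, not only
  of polynomials: it is the transpose, with respect to the weighted inner products, of
  \<open>ultra_weighted\<close>, and the relations between the norms turn the coefficients of the latter into those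
  of \<open>conv_op l\<close>.
\<close>
lemma ultra_coeff_Suc:
  assumes f: "continuous_on {-1..1} f"
  shows "ultra_coeff (Suc l) f j = conv_diag l j * ultra_coeff l f j
      - conv_diag l (j + 2) * ultra_coeff l f (j + 2)"
proof -
  have lo: "weight_lo l j / ultra_norm2 (Suc l) j = conv_diag l j / ultra_norm2 l j"
    using ultra_norm2_Suc_lo[of l j] ultra_norm2_pos[of l j] ultra_norm2_pos[of "Suc l" j]
    by (simp add: field_simps)
  have hi: "weight_hi l j / ultra_norm2 (Suc l) j = conv_diag l (j + 2) / ultra_norm2 l (j + 2)"
    using ultra_norm2_Suc_hi[of l j] ultra_norm2_pos[of l "j + 2"] ultra_norm2_pos[of "Suc l" j]
    by (simp add: field_simps)
  have "ultra_coeff (Suc l) f j = weight_lo l j / ultra_norm2 (Suc l) j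
      * ultra_int l (\<lambda>x. f x * ultra l j x)
      - weight_hi l j / ultra_norm2 (Suc l) j * ultra_int l (\<lambda>x. f x * ultra l (j + 2) x)"
    by (simp add: ultra_coeff_eq f ultra_int_Suc_ultra diff_divide_distrib)
  then show ?thesis unfolding lo hi by (simp add: ultra_coeff_eq f)
qed

lemma ultra_norm2_Suc_le:
  assumes "l \<ge> 1"
  shows "ultra_norm2 (Suc l) j \<le> 2 * (real j + 1)\<^sup>2 * ultra_norm2 l j"
proof -
  define L where "L = real l"
  define m where "m = real j"
  have L: "L \<ge> 1" "m \<ge> 0" using assms by (auto simp: L_def m_def)
  have mL: "m * L \<ge> m" using L mult_left_mono[of 1 L m] by simp
  have eq: "weight_lo l j / conv_diag l j = ((m + 2 * L) * (m + 2 * L + 1))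
      * ((L + m) / (m + L + 1)) / (4 * L\<^sup>2)"
    using assms by (simp add: weight_lo_def conv_op_def L_def m_def power2_eq_square field_simps)
  have "(L + m) / (m + L + 1) \<le> 1" using L by simp
  moreover have "(m + 2 * L) * (m + 2 * L + 1) \<le> (2 * L * (m + 1)) * (4 * L * (m + 1))"
  proof (intro mult_mono)
    have e: "2 * L * (m + 1) = 2 * (m * L) + 2 * L" "4 * L * (m + 1) = 4 * (m * L) + 4 * L"
      by (simp_all add: algebra_simps)
    show "m + 2 * L \<le> 2 * L * (m + 1)" "m + 2 * L + 1 \<le> 4 * L * (m + 1)"
      unfolding e using L mL by linarith+
  qed (use L in auto)
  ultimately have "((m + 2 * L) * (m + 2 * L + 1)) * ((L + m) / (m + L + 1))
      \<le> (2 * L * (m + 1)) * (4 * L * (m + 1)) * 1"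
    using L by (intro mult_mono[of "_ * _" "_ * _" "_ / _"]) auto
  also have "\<dots> = 2 * (m + 1)\<^sup>2 * (4 * L\<^sup>2)" by (simp add: power2_eq_square)
  finally have "weight_lo l j / conv_diag l j \<le> 2 * (m + 1)\<^sup>2"
    unfolding eq using L by (subst pos_divide_le_eq) simp_all
  then have "weight_lo l j / conv_diag l j * ultra_norm2 l j \<le> 2 * (m + 1)\<^sup>2 * ultra_norm2 l j"
    using ultra_norm2_pos[of l j] by (intro mult_right_mono) auto
  moreover have "ultra_norm2 (Suc l) j = weight_lo l j / conv_diag l j * ultra_norm2 l j"
    using ultra_norm2_Suc_lo[of l j] conv_diag_pos[of l j] by (simp add: field_simps)
  ultimately show ?thesis by (simp add: m_def)
qed

lemma ultra_norm2_1_le: "ultra_norm2 1 j \<le> pi"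
proof -
  have "2 * ultra_norm2 1 j = pi"
    using ultra_norm2_Suc_lo[of 0 j] by (auto simp: weight_lo_def conv_op_def ultra_norm2_0 split:
        if_splits)
  then show ?thesis using pi_gt_zero by linarith
qed

text \<open>
  The growth in \<open>j\<close> is of the correct order; it is what leaves exactly \<open>n^(2l)\<close> in \<open>diff_op_norm2_le\<close>.
\<close>
lemma ultra_norm2_le: "ultra_norm2 (Suc l) j \<le> pi * 2 ^ l * (real j + 1) ^ (2 * l)"
proof (induction l)
  case 0
  then show ?case using ultra_norm2_1_le[of j] by simp
next
  case (Suc l)
  have "ultra_norm2 (Suc (Suc l)) j \<le> 2 * (real j + 1)\<^sup>2 * ultra_norm2 (Suc l) j"
    by (rule ultra_norm2_Suc_le) simp
  also have "\<dots> \<le> 2 * (real j + 1)\<^sup>2 * (pi * 2 ^ l * (real j + 1) ^ (2 * l))"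
    by (intro mult_left_mono Suc.IH) auto
  finally show ?case by (simp add: power2_eq_square mult_ac)
qed

text \<open>
  Since \<open>conv_diag l k * ultra_norm2 (Suc l) k = weight_lo l k * ultra_norm2 l k\<close>, this amounts to the
  product \<open>weight_lo l k * conv_diag l k\<close> being at least \<open>1 / 4\<close>.
\<close>
lemma ultra_norm2_conv_le: "ultra_norm2 l k \<le> 4 * (conv_diag l k)\<^sup>2 * ultra_norm2 (Suc l) k"
proof -
  have "1 / 4 \<le> weight_lo l k * conv_diag l k"
  proof (cases "l = 0")
    case True
    then show ?thesis by (simp add: weight_lo_def conv_op_def)
  next
    case False
    define L where "L = real l"
    define m where "m = real k"
    have L: "L \<ge> 1" "m \<ge> 0" using False by (auto simp: L_def m_def)
    have "(m + L + 1) * (m + L) \<le> (m + 2 * L + 1) * (m + 2 * L)"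
      using L by (intro mult_mono) auto
    then have "1 / 4 \<le> ((m + 2 * L + 1) * (m + 2 * L)) / (4 * ((m + L + 1) * (m + L)))"
      using L by (simp add: le_divide_eq mult_pos_pos)
    also have "\<dots> = weight_lo l k * conv_diag l k"
      using False by (simp add: weight_lo_def conv_op_def L_def m_def add_ac mult_ac)
    finally show ?thesis .
  qed
  then have "ultra_norm2 l k \<le> 4 * (weight_lo l k * conv_diag l k) * ultra_norm2 l k"
    using ultra_norm2_pos[of l k] by simp
  also have "\<dots> = 4 * conv_diag l k * (weight_lo l k * ultra_norm2 l k)" by simp
  also have "\<dots> = 4 * (conv_diag l k)\<^sup>2 * ultra_norm2 (Suc l) k"
    unfolding ultra_norm2_Suc_lo[symmetric] by (simp add: power2_eq_square)
  finally show ?thesis .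
qed

text \<open>
  The two relations between the norms for \<open>l\<close> and \<open>l + 1\<close> contain the same \<open>ultra_norm2 (Suc l) j\<close>, so
  that dividing them gives the ratio of \<open>ultra_norm2 l (j + 2)\<close> and \<open>ultra_norm2 l j\<close> explicitly. For
  \<open>l = 0\<close> the norm drops from \<open>j = 0\<close> to \<open>j = 2\<close>.
\<close>
lemma ultra_norm2_step_mono:
  assumes "l \<ge> 1"
  shows "ultra_norm2 l j \<le> ultra_norm2 l (j + 2)"
proof -
  define L where "L = real l - 1"
  define m where "m = real j"
  have L: "L \<ge> 0" "m \<ge> 0" "real l = L + 1" using assms by (auto simp: L_def m_def)
  have XY: "(m + L + 3) * ((m + 1) * (m + 2)) \<le> (m + L + 1) * ((m + 2 * L + 2) * (m + 2 * L + 3))"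
  proof -
    have "(m + L + 1) * ((m + 2 * L + 2) * (m + 2 * L + 3)) - (m + L + 3) * ((m + 1) * (m + 2)) =
       4 * L^3 + 14 * L\<^sup>2 + 14 * L + 8 * m * L\<^sup>2 + 16 * m * L + 4 * m\<^sup>2 * L"
      by (simp add: algebra_simps power2_eq_square power3_eq_cube)
    also have "\<dots> \<ge> 0" using L by simp
    finally show ?thesis by simp
  qed
  then have *: "weight_hi l j * conv_diag l j \<le> weight_lo l j * conv_diag l (j + 2)"
  proof -
    define d where "d = 4 * (L + 1) * (m + (L + 1) + 1)"
    define X where "X = (m + 1) * (m + 2)"
    define Y where "Y = (m + 2 * L + 2) * (m + 2 * L + 3)"
    have "d > 0" using L by (simp add: d_def)
    have "X / (m + L + 1) \<le> Y / (m + L + 3)"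
      using XY L by (simp add: X_def Y_def divide_le_eq le_divide_eq mult.commute)
    then have "X / (m + L + 1) * ((L + 1) / d) \<le> Y / (m + L + 3) * ((L + 1) / d)"
      using L \<open>d > 0\<close> by (intro mult_right_mono) auto
    moreover have "weight_hi l j * conv_diag l j = X / (m + L + 1) * ((L + 1) / d)"
      using assms L by (simp add: weight_hi_def conv_op_def d_def X_def m_def add_ac mult_ac)
    moreover have "weight_lo l j * conv_diag l (j + 2) = Y / (m + L + 3) * ((L + 1) / d)"
    proof -
      have "real j + 2 * real l = m + 2 * L + 2" "real j + 2 * real l + 1 = m + 2 * L + 3"
        using L by (simp_all add: m_def)
      moreover have "real l + real (j + 2) = m + L + 3" using L by (simp add: m_def)
      ultimately show ?thesis
        using assms L by (simp add: weight_lo_def conv_op_def d_def Y_def m_def[symmetric] add_ac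
            mult_ac)
    qed
    ultimately show ?thesis by simp
  qed
  let ?H = "ultra_norm2 (Suc l) j"
  have "weight_lo l j * weight_hi l j * ultra_norm2 l j = weight_hi l j * conv_diag l j * ?H"
    using ultra_norm2_Suc_lo[of l j] by (simp add: mult_ac)
  also have "\<dots> \<le> weight_lo l j * conv_diag l (j + 2) * ?H"
    using * ultra_norm2_pos[of "Suc l" j] by (intro mult_right_mono) auto
  also have "\<dots> = weight_lo l j * weight_hi l j * ultra_norm2 l (j + 2)"
    using ultra_norm2_Suc_hi[of l j] by (simp add: mult_ac)
  finally show ?thesis using weight_lo_pos[of l j] weight_hi_pos[of l j] by simp
qed

section \<open>Polynomials of bounded degree and the cost of lowering the weight\<close>

definition ultra_sum :: "nat \<Rightarrow> nat \<Rightarrow> (nat \<Rightarrow> real) \<Rightarrow> real \<Rightarrow> real" where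
  "ultra_sum n l c x = (\<Sum>k<n. c k * ultra l k x)"

lemma continuous_ultra_sum [continuous_intros]: "continuous_on A (ultra_sum n l c)"
  unfolding ultra_sum_def by (intro continuous_intros)

lemma ultra_int_mult_ultra_sum:
  assumes "continuous_on {-1..1} f"
  shows "ultra_int m (\<lambda>x. f x * ultra_sum n l c x)
      = (\<Sum>k<n. c k * ultra_int m (\<lambda>x. f x * ultra l k x))"
proof -
  have "ultra_int m (\<lambda>x. f x * ultra_sum n l c x) = ultra_int m (\<lambda>x. \<Sum>k<n. c k * (f x * ultra l k x))"
    by (simp add: ultra_sum_def sum_distrib_left mult_ac)
  also have "\<dots> = (\<Sum>k<n. ultra_int m (\<lambda>x. c k * (f x * ultra l k x)))"
    by (intro ultra_int_sum continuous_intros assms) auto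
  finally show ?thesis by (simp add: ultra_int_cmult)
qed

lemma ultra_sum_parseval:
  "ultra_int l (\<lambda>x. ultra_sum n l c x * ultra_sum n l d x) = (\<Sum>k<n. c k * d k * ultra_norm2 l k)"
proof -
  have "ultra_int l (\<lambda>x. ultra_sum n l c x * ultra l k x) = c k * ultra_norm2 l k" if "k < n" for k
  proof -
    have "ultra_int l (\<lambda>x. ultra_sum n l c x * ultra l k x)
        = (\<Sum>i<n. c i * ultra_int l (\<lambda>x. ultra l k x * ultra l i x))"
      using ultra_int_mult_ultra_sum[of "ultra l k" l n l c]
      by (simp add: continuous_ultra mult.commute)
    also have "\<dots> = (\<Sum>i<n. if i = k then c k * ultra_norm2 l k else 0)"
      by (intro sum.cong) (auto simp: ultra_orthogonal ultra_norm2_def power2_eq_square)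
    finally show ?thesis using that by simp
  qed
  then show ?thesis
    by (subst ultra_int_mult_ultra_sum) (auto intro!: continuous_intros sum.cong)
qed

lemma ultra_sum_parseval_square:
  "ultra_int l (\<lambda>x. (ultra_sum n l c x)\<^sup>2) = (\<Sum>k<n. (c k)\<^sup>2 * ultra_norm2 l k)"
  using ultra_sum_parseval[of l n c c] by (simp add: power2_eq_square)

abbreviation cheb_norm2 :: "nat \<Rightarrow> nat \<Rightarrow> (nat \<Rightarrow> real) \<Rightarrow> real" where
  "cheb_norm2 l n c \<equiv> ultra_int l (\<lambda>x. (ultra_sum n 0 c x)\<^sup>2)"

definition conv_seq :: "nat \<Rightarrow> (nat \<Rightarrow> real) \<Rightarrow> nat \<Rightarrow> real" where
  "conv_seq l c j = conv_diag l j * c j - conv_diag l (j + 2) * c (j + 2)"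

lemma ultra_sum_conv:
  assumes "\<And>k. k \<ge> n \<Longrightarrow> c k = 0"
  shows "ultra_sum n l c x = ultra_sum n (Suc l) (conv_seq l c) x"
proof -
  define e where "e k = conv_diag l k * c k" for k
  have e0: "e k = 0" if "k \<ge> n" for k using assms that by (simp add: e_def)
  have "ultra_sum n l c x = (\<Sum>k<n. e k * (ultra (Suc l) k x
      - (if k < 2 then 0 else ultra (Suc l) (k - 2) x)))"
    unfolding ultra_sum_def e_def by (subst ultra_conv) (simp add: mult_ac)
  also have "\<dots> = (\<Sum>k<n. e k * ultra (Suc l) k x)
      - (\<Sum>k<n. e k * (if k < 2 then 0 else ultra (Suc l) (k - 2) x))"
    by (simp add: right_diff_distrib sum_subtractf)
  also have "(\<Sum>k<n. e k * (if k < 2 then 0 else ultra (Suc l) (k - 2) x)) =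
      (\<Sum>k<Suc (Suc n). e k * (if k < 2 then 0 else ultra (Suc l) (k - 2) x))"
    using e0[of n] e0[of "Suc n"] by simp
  also have "\<dots> = (\<Sum>k<n. e (k + 2) * ultra (Suc l) k x)"
    by (simp add: sum.lessThan_Suc_shift del: sum.lessThan_Suc)
  finally show ?thesis
    by (simp add: ultra_sum_def conv_seq_def e_def left_diff_distrib sum_subtractf)
qed

lemma ultra_norm2_mono_add:
  assumes "l \<ge> 1"
  shows "ultra_norm2 l j \<le> ultra_norm2 l (j + 2 * i)"
proof (induction i)
  case (Suc i)
  also have "ultra_norm2 l (j + 2 * i) \<le> ultra_norm2 l (j + 2 * i + 2)"
    using assms by (rule ultra_norm2_step_mono)
  finally show ?case by simp
qed simp

text \<open>
  Schur's inequality in terms of coefficients. With \<open>e k = conv_diag l k * c k\<close> the converted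
  coefficients are the differences \<open>e j - e (j + 2)\<close>, so \<open>e k\<close> is the sum of every second one from \<open>k\<close>
  onwards. This sum has at most \<open>n\<close> nonzero terms, and as the norms increase along it, Cauchy-Schwarz
  bounds each of the \<open>n\<close> weighted squares of the \<open>e k\<close> by \<open>n\<close> times the right-hand sum.
\<close>
lemma conv_seq_inverse_bound:
  assumes c: "\<And>k. k \<ge> n \<Longrightarrow> c k = 0"
  shows "(\<Sum>k<n. (c k)\<^sup>2 * ultra_norm2 l k)
    \<le> 4 * (real n)\<^sup>2 * (\<Sum>j<n. (conv_seq l c j)\<^sup>2 * ultra_norm2 (Suc l) j)"
proof -
  define e where "e k = conv_diag l k * c k" for k
  define b where "b = conv_seq l c"
  define B where "B = (\<Sum>j<n. (b j)\<^sup>2 * ultra_norm2 (Suc l) j)"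
  have b: "b j = e j - e (j + 2)" for j by (simp add: b_def conv_seq_def e_def)
  have e0: "e k = 0" if "k \<ge> n" for k using c that by (simp add: e_def)
  have b0: "b j = 0" if "j \<ge> n" for j using that e0 by (simp add: b)
  have tele: "(\<Sum>i<m. b (k + 2 * i)) = e k - e (k + 2 * m)" for k m
    by (induction m) (simp_all add: b add_ac)
  have *: "(e k)\<^sup>2 * ultra_norm2 (Suc l) k \<le> real n * B" for k
  proof -
    have "e k = (\<Sum>i<n. b (k + 2 * i))" using tele[where m = n] e0[of "k + 2 * n"] by simp
    then have "(e k)\<^sup>2 \<le> real n * (\<Sum>i<n. (b (k + 2 * i))\<^sup>2)"
      using sum_squared_le_sum_of_squares[of "\<lambda>i. b (k + 2 * i)" "{..<n}"] by (simp add: mult.commute)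
    then have "(e k)\<^sup>2 * ultra_norm2 (Suc l) k
        \<le> real n * (\<Sum>i<n. (b (k + 2 * i))\<^sup>2) * ultra_norm2 (Suc l) k"
      using ultra_norm2_pos[of "Suc l" k] by (intro mult_right_mono) auto
    also have "\<dots> = real n * (\<Sum>i<n. (b (k + 2 * i))\<^sup>2 * ultra_norm2 (Suc l) k)"
      by (simp add: sum_distrib_right mult.assoc)
    also have "\<dots> \<le> real n * (\<Sum>i<n. (b (k + 2 * i))\<^sup>2 * ultra_norm2 (Suc l) (k + 2 * i))"
      by (intro mult_left_mono sum_mono ultra_norm2_mono_add) auto
    also have "(\<Sum>i<n. (b (k + 2 * i))\<^sup>2 * ultra_norm2 (Suc l) (k + 2 * i)) =
        (\<Sum>j\<in>(\<lambda>i. k + 2 * i) ` {..<n}. (b j)\<^sup>2 * ultra_norm2 (Suc l) j)"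
      by (subst sum.reindex) (auto simp: inj_on_def)
    also have "\<dots> = (\<Sum>j\<in>(\<lambda>i. k + 2 * i) ` {..<n} \<inter> {..<n}. (b j)\<^sup>2 * ultra_norm2 (Suc l) j)"
      by (intro sum.mono_neutral_right) (auto simp: not_less b0)
    also have "\<dots> \<le> B" unfolding B_def
      using ultra_norm2_pos[of "Suc l"] by (intro sum_mono2) (auto simp: less_imp_le)
    finally show ?thesis by (simp add: mult_left_mono)
  qed
  have "(\<Sum>k<n. (c k)\<^sup>2 * ultra_norm2 l k) \<le> (\<Sum>k<n. 4 * (real n * B))"
  proof (intro sum_mono)
    fix k
    have "(c k)\<^sup>2 * ultra_norm2 l k \<le> (c k)\<^sup>2 * (4 * (conv_diag l k)\<^sup>2 * ultra_norm2 (Suc l) k)"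
      by (intro mult_left_mono ultra_norm2_conv_le) auto
    also have "\<dots> = 4 * ((e k)\<^sup>2 * ultra_norm2 (Suc l) k)" by (simp add: e_def power_mult_distrib)
    also have "\<dots> \<le> 4 * (real n * B)" using * by simp
    finally show "(c k)\<^sup>2 * ultra_norm2 l k \<le> 4 * (real n * B)" .
  qed
  then show ?thesis by (simp add: B_def b_def power2_eq_square mult_ac)
qed

text \<open>
  A polynomial of degree below \<open>n\<close> can be expanded in every family, and \<open>l\<close>-fold use of Schur's
  inequality compares its norms.
\<close>
lemma ultra_sum_raise:
  "\<exists>d. ultra_sum n 0 c = ultra_sum n l d \<and>
     cheb_norm2 0 n c \<le> (4 * (real n)\<^sup>2) ^ l * cheb_norm2 l n c"
proof (induction l)
  case 0
  then show ?case by auto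
next
  case (Suc l)
  then obtain d where d: "ultra_sum n 0 c = ultra_sum n l d"
    and le: "cheb_norm2 0 n c \<le> (4 * (real n)\<^sup>2) ^ l * cheb_norm2 l n c"
    by blast
  \<comment> \<open>Only the entries of \<open>d\<close> below \<open>n\<close> matter, but \<open>conv_seq\<close> would also look at the next two.\<close>
  define d' where "d' k = (if k < n then d k else 0)" for k
  have d': "ultra_sum n l d = ultra_sum n l d'" by (auto simp: ultra_sum_def d'_def)
  have s: "ultra_sum n l d' = ultra_sum n (Suc l) (conv_seq l d')"
    by (intro ext ultra_sum_conv) (simp add: d'_def)
  have "cheb_norm2 l n c = (\<Sum>k<n. (d' k)\<^sup>2 * ultra_norm2 l k)"
    unfolding d d' by (rule ultra_sum_parseval_square)
  also have "\<dots> \<le> 4 * (real n)\<^sup>2 * (\<Sum>j<n. (conv_seq l d' j)\<^sup>2 * ultra_norm2 (Suc l) j)"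
    by (rule conv_seq_inverse_bound) (simp add: d'_def)
  also have "\<dots> = 4 * (real n)\<^sup>2 * cheb_norm2 (Suc l) n c"
    unfolding d d' s by (simp add: ultra_sum_parseval_square)
  finally have "(4 * (real n)\<^sup>2) ^ l * cheb_norm2 l n c
      \<le> (4 * (real n)\<^sup>2) ^ l * (4 * (real n)\<^sup>2 * cheb_norm2 (Suc l) n c)"
    by (intro mult_left_mono) auto
  with le have "cheb_norm2 0 n c
      \<le> (4 * (real n)\<^sup>2) ^ Suc l * cheb_norm2 (Suc l) n c"
    unfolding power_Suc2 mult.assoc by (rule order_trans)
  moreover have "ultra_sum n 0 c = ultra_sum n (Suc l) (conv_seq l d')"
    using d d' s by simp
  ultimately show ?case by blast
qed

section \<open>Derivatives\<close>

text \<open>The \<open>l\<close>-th derivative of \<open>cheb_T k\<close>, read off from column \<open>k\<close> of \<open>diff_op l\<close>.\<close>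
definition cheb_deriv :: "nat \<Rightarrow> nat \<Rightarrow> real \<Rightarrow> real" where
  "cheb_deriv l k x = (if k < l then 0 else diff_op l (k - l) k * ultra l (k - l) x)"

lemma continuous_cheb_deriv [continuous_intros]: "continuous_on A (cheb_deriv l k)"
  unfolding cheb_deriv_def by (cases "k < l") (auto intro!: continuous_intros)

definition sum_deriv :: "nat \<Rightarrow> nat \<Rightarrow> (nat \<Rightarrow> real) \<Rightarrow> real \<Rightarrow> real" where
  "sum_deriv n l c x = (\<Sum>k<n. c k * cheb_deriv l k x)"

lemma continuous_sum_deriv [continuous_intros]: "continuous_on A (sum_deriv n l c)"
  unfolding sum_deriv_def by (intro continuous_intros)

lemma sum_deriv_eq: "sum_deriv n l c = ultra_sum (n - l) l (\<lambda>k. c (k + l) * diff_op l k (k + l))"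
proof
  fix x
  have "sum_deriv n l c x = (\<Sum>k\<in>{l..<n}. c k * (diff_op l (k - l) k * ultra l (k - l) x))"
    unfolding sum_deriv_def cheb_deriv_def by (intro sum.mono_neutral_cong_right) auto
  also have "\<dots> = (\<Sum>k<n - l. c (k + l) * (diff_op l k (k + l) * ultra l k x))"
    by (rule sum.reindex_bij_witness[of _ "\<lambda>k. k + l" "\<lambda>k. k - l"]) auto
  finally show "sum_deriv n l c x = ultra_sum (n - l) l (\<lambda>k. c (k + l) * diff_op l k (k + l)) x"
    by (simp add: ultra_sum_def mult.assoc)
qed

text \<open>
  The ratio of the squared norms of the \<open>l\<close>-th derivative of \<open>cheb_T (k + l)\<close> and of \<open>cheb_T (k + l)\<close>
  itself: the entry of \<open>diff_op l\<close> contributes \<open>n\<^sup>2\<close> and the norm of \<open>ultra l k\<close> the remaining \<open>n^(2l-2)\<close>.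
\<close>
lemma diff_op_norm2_le:
  obtains K :: real where "K \<ge> 0" "\<And>k n. k + l < n \<Longrightarrow> (diff_op l k (k + l))\<^sup>2 * ultra_norm2 l k
      \<le> K * real n ^ (2 * l) * ultra_norm2 0 (k + l)"
proof (cases l)
  case 0
  then show ?thesis using that[of 1] by (simp add: diff_op_def)
next
  case (Suc m)
  define K :: real where "K = (2 ^ m * fact m)\<^sup>2 * 2 * 2 ^ m"
  have "(diff_op l k (k + l))\<^sup>2 * ultra_norm2 l k
      \<le> K * real n ^ (2 * l) * ultra_norm2 0 (k + l)" if "k + l < n" for k n
  proof -
    have "(diff_op l k (k + l))\<^sup>2 * ultra_norm2 l k
        = (2 ^ m * fact m)\<^sup>2 * (real (l + k))\<^sup>2 * ultra_norm2 l k"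
      using Suc by (simp add: diff_op_def power_mult_distrib)
    also have "\<dots> \<le> (2 ^ m * fact m)\<^sup>2 * (real n)\<^sup>2 * (pi * 2 ^ m * real n ^ (2 * m))"
    proof (intro mult_mono power_mono order.refl)
      have "ultra_norm2 l k \<le> pi * 2 ^ m * (real k + 1) ^ (2 * m)" using ultra_norm2_le Suc by blast
      also have "\<dots> \<le> pi * 2 ^ m * real n ^ (2 * m)"
        using that Suc by (intro mult_left_mono power_mono) auto
      finally show "ultra_norm2 l k \<le> pi * 2 ^ m * real n ^ (2 * m)" .
    qed (use that ultra_norm2_pos[of l k] in auto)
    also have "\<dots> = K * real n ^ (2 * l) * (pi / 2)"
      using Suc by (simp add: K_def power2_eq_square mult_ac)
    also have "\<dots> = K * real n ^ (2 * l) * ultra_norm2 0 (k + l)" using Suc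
      by (simp add: ultra_norm2_0)
    finally show ?thesis .
  qed
  moreover have "K \<ge> 0" by (simp add: K_def)
  ultimately show ?thesis using that by blast
qed

text \<open>
  Bernstein's inequality: by orthogonality of the derivatives it reduces to the single terms.
\<close>
lemma sum_deriv_bound:
  obtains K :: real where "K \<ge> 0" "\<And>n c. ultra_int l (\<lambda>x. (sum_deriv n l c x)\<^sup>2)
      \<le> K * real n ^ (2 * l) * cheb_norm2 0 n c"
proof -
  obtain K :: real where K: "K \<ge> 0" "\<And>k n. k + l < n \<Longrightarrow> (diff_op l k (k + l))\<^sup>2 * ultra_norm2 l k
      \<le> K * real n ^ (2 * l) * ultra_norm2 0 (k + l)"
    using diff_op_norm2_le[of l] by blast
  have "ultra_int l (\<lambda>x. (sum_deriv n l c x)\<^sup>2) \<le> K * real n ^ (2 * l) * cheb_norm2 0 n c" for n c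
  proof -
    have "ultra_int l (\<lambda>x. (sum_deriv n l c x)\<^sup>2)
        = (\<Sum>k<n - l. (c (k + l))\<^sup>2 * ((diff_op l k (k + l))\<^sup>2 * ultra_norm2 l k))"
      unfolding sum_deriv_eq ultra_sum_parseval_square by (simp add: power_mult_distrib mult.assoc)
    also have "\<dots> \<le> (\<Sum>k<n - l. (c (k + l))\<^sup>2 * (K * real n ^ (2 * l) * ultra_norm2 0 (k + l)))"
      by (intro sum_mono mult_left_mono K) auto
    also have "\<dots> = (\<Sum>k\<in>{l..<n}. (c k)\<^sup>2 * (K * real n ^ (2 * l) * ultra_norm2 0 k))"
      by (rule sum.reindex_bij_witness[of _ "\<lambda>k. k - l" "\<lambda>k. k + l"]) auto
    also have "\<dots> \<le> (\<Sum>k<n. (c k)\<^sup>2 * (K * real n ^ (2 * l) * ultra_norm2 0 k))"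
      using K(1) ultra_norm2_pos[of 0] by (intro sum_mono2)
          (auto intro!: mult_nonneg_nonneg simp: less_imp_le)
    also have "\<dots> = K * real n ^ (2 * l) * cheb_norm2 0 n c"
      unfolding ultra_sum_parseval_square by (simp add: sum_distrib_left mult_ac)
    finally show ?thesis .
  qed
  with K(1) show ?thesis using that by blast
qed

section \<open>The infinite matrix of the differential operator\<close>

lemma ultra_coeff_cmult:
  assumes "continuous_on {-1..1} f"
  shows "ultra_coeff l (\<lambda>x. c * f x) j = c * ultra_coeff l f j"
  using assms by (simp add: ultra_coeff_eq continuous_on_mult_left mult.assoc ultra_int_cmult)

lemma ultra_coeff_sum:
  assumes "finite A" "\<And>i. i \<in> A \<Longrightarrow> continuous_on {-1..1} (f i)"
  shows "ultra_coeff l (\<lambda>x. \<Sum>i\<in>A. f i x) j = (\<Sum>i\<in>A. ultra_coeff l (f i) j)"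
proof -
  have "ultra_int l (\<lambda>x. \<Sum>i\<in>A. f i x * ultra l j x) = (\<Sum>i\<in>A. ultra_int l (\<lambda>x. f i x * ultra l j x))"
    using assms by (intro ultra_int_sum continuous_intros) auto
  then show ?thesis
    using assms by (simp add: ultra_coeff_eq continuous_on_sum sum_distrib_right sum_divide_distrib)
qed

lemma mult_diff_eq:
  assumes "continuous_on {-1..1} f"
  shows "imult (mult_op l f) (diff_op l) j k = ultra_coeff l (\<lambda>x. f x * cheb_deriv l k x) j"
proof (cases "k < l")
  case True
  then show ?thesis by (simp add: imult_diff_op cheb_deriv_def ultra_coeff_def)
next
  case False
  have "ultra_coeff l (\<lambda>x. diff_op l (k - l) k * (f x * ultra l (k - l) x)) j
      = diff_op l (k - l) k * mult_op l f j (k - l)"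
    unfolding mult_op_def by (intro ultra_coeff_cmult continuous_intros assms)
  then show ?thesis using False by (simp add: imult_diff_op cheb_deriv_def mult_ac)
qed

text \<open>Each factor \<open>conv_op\<close> raises the index of the family by one, by \<open>ultra_coeff_Suc\<close>.\<close>
lemma conv_chain_eq:
  assumes "l \<le> N" "continuous_on {-1..1} f" "\<And>j. B j k = ultra_coeff l f j"
  shows "foldr imult (map conv_op (rev [l..<N])) B j k = ultra_coeff N f j"
  using assms(1)
proof (induction N arbitrary: j rule: dec_induct)
  case base
  then show ?case by (simp add: assms)
next
  case (step N)
  then show ?case
    by (simp add: imult_conv_op ultra_coeff_Suc assms(2) conv_op_band[of N j "Suc (Suc j)"])
qed

text \<open>The differential operator with coefficients \<open>a\<close> applied to \<open>cheb_T k\<close>.\<close>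
definition operator_on_cheb :: "nat \<Rightarrow> (nat \<Rightarrow> real \<Rightarrow> real) \<Rightarrow> nat \<Rightarrow> real \<Rightarrow> real" where
  "operator_on_cheb N a k x = (\<Sum>l\<le>N. a l x * cheb_deriv l k x)"

lemma continuous_operator_on_cheb:
  assumes "\<And>l. l \<le> N \<Longrightarrow> continuous_on {-1..1} (a l)"
  shows "continuous_on {-1..1} (operator_on_cheb N a k)"
  unfolding operator_on_cheb_def using assms by (intro continuous_intros) auto

lemma ultra_rep_eq:
  assumes a: "\<And>l. l \<le> N \<Longrightarrow> continuous_on {-1..1} (a l)"
  shows "ultra_rep N a j k = ultra_coeff N (operator_on_cheb N a k) j"
proof -
  have "ultra_rep N a j k = ultra_coeff N (\<lambda>x. a N x * cheb_deriv N k x) j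
      + (\<Sum>l<N. ultra_coeff N (\<lambda>x. a l x * cheb_deriv l k x) j)"
    unfolding ultra_rep_def
  proof (intro arg_cong2[where f = "(+)"] sum.cong refl)
    show "imult (mult_op N (a N)) (diff_op N) j k = ultra_coeff N (\<lambda>x. a N x * cheb_deriv N k x) j"
      by (intro mult_diff_eq a) simp
    fix l assume "l \<in> {..<N}"
    then have l: "l \<le> N" by simp
    show "foldr imult (map conv_op (rev [l..<N])) (imult (mult_op l (a l)) (diff_op l)) j k =
        ultra_coeff N (\<lambda>x. a l x * cheb_deriv l k x) j"
      using a[OF l] by (intro conv_chain_eq mult_diff_eq l continuous_intros)
  qed
  also have "\<dots> = (\<Sum>l\<le>N. ultra_coeff N (\<lambda>x. a l x * cheb_deriv l k x) j)"
    by (simp flip: lessThan_Suc_atMost)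
  also have "\<dots> = ultra_coeff N (operator_on_cheb N a k) j"
    unfolding operator_on_cheb_def using a by (intro ultra_coeff_sum[symmetric] continuous_intros)
        auto
  finally show ?thesis .
qed

section \<open>The quadratic form of the differential operator\<close>

lemma ultra_int_abs_le:
  assumes "continuous_on {-1..1} f" "continuous_on {-1..1} g"
    and "\<And>x. x \<in> {-1..1} \<Longrightarrow> \<bar>f x\<bar> \<le> g x"
  shows "\<bar>ultra_int l f\<bar> \<le> ultra_int l g"
proof -
  have "ultra_int l f \<le> ultra_int l g"
    using assms by (intro ultra_int_mono) force+
  moreover have "ultra_int l (\<lambda>x. - 1 * f x) \<le> ultra_int l g"
    using assms by (intro ultra_int_mono continuous_intros) force+
  ultimately show ?thesis by (simp only: ultra_int_cmult)
qed

lemma sum_operator_on_cheb: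
  "(\<Sum>k<n. c k * operator_on_cheb N a k x) = (\<Sum>l\<le>N. a l x * sum_deriv n l c x)"
  unfolding operator_on_cheb_def sum_deriv_def sum_distrib_left
  by (subst sum.swap) (simp add: mult_ac)

text \<open>
  The weighted inequality \<open>\<bar>q p\<bar> \<le> q\<^sup>2 / R + R p\<^sup>2\<close> with \<open>R = n^(2N)\<close> balances the two norms: by Bernstein
  and Schur the integral of \<open>(sum_deriv n l c)\<^sup>2\<close> is of order \<open>R\<^sup>2\<close>. Bernstein's inequality, which is
  about the weight for \<open>l\<close>, applies because \<open>sin t ^ (2 * N) \<le> sin t ^ (2 * l)\<close>.
\<close>
lemma deriv_term_bound:
  assumes a: "continuous_on {-1..1} a" and "l \<le> N"
  shows "\<exists>M\<ge>0. \<forall>n\<ge>1. \<forall>c d. \<bar>ultra_int N (\<lambda>x. a x * sum_deriv n l c x * ultra_sum n 0 d x)\<bar>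
     \<le> M * real n ^ (2 * N) * (cheb_norm2 N n c + cheb_norm2 N n d)"
proof -
  obtain B where B: "\<And>x. x \<in> {-1..1} \<Longrightarrow> \<bar>a x\<bar> \<le> B" and B0: "B \<ge> 0"
  proof -
    have "bounded (a ` {-1..1})"
      by (intro compact_imp_bounded compact_continuous_image a) simp
    then obtain B where "\<forall>x\<in>{-1..1}. \<bar>a x\<bar> \<le> B" by (auto simp: bounded_iff)
    moreover from this have "B \<ge> 0" using abs_ge_zero[of "a 0"]
      by (intro order.trans[OF abs_ge_zero[of "a 0"]]) auto
    ultimately show ?thesis using that by blast
  qed
  obtain K where K0: "K \<ge> 0" and K: "\<And>n c. ultra_int l (\<lambda>x. (sum_deriv n l c x)\<^sup>2)
      \<le> K * real n ^ (2 * l) * cheb_norm2 0 n c"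
    using sum_deriv_bound[of l] by blast
  show ?thesis
  proof (intro exI[of _ "B * (K * 4 ^ N + 1)"] conjI allI impI)
    show "B * (K * 4 ^ N + 1) \<ge> 0" using B0 K0 by simp
    fix n :: nat and c d assume n: "n \<ge> 1"
    define R where "R = real n ^ (2 * N)"
    define G where "G c = cheb_norm2 N n c" for c
    have R: "R \<ge> 1" using n by (simp add: R_def)
    have G0: "G c \<ge> 0" for c unfolding G_def by (intro ultra_int_nonneg continuous_intros) auto
    have deriv: "ultra_int N (\<lambda>x. (sum_deriv n l c x)\<^sup>2) \<le> K * 4 ^ N * R\<^sup>2 * G c"
    proof -
      obtain e where e: "cheb_norm2 0 n c \<le> (4 * (real n)\<^sup>2) ^ N * G c"
        using ultra_sum_raise[of n c N] unfolding G_def by blast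
      have "ultra_int N (\<lambda>x. (sum_deriv n l c x)\<^sup>2) \<le> ultra_int l (\<lambda>x. (sum_deriv n l c x)\<^sup>2)"
        using \<open>l \<le> N\<close> by (intro ultra_int_weight_mono continuous_intros) auto
      also have "\<dots> \<le> K * real n ^ (2 * l) * cheb_norm2 0 n c" by (rule K)
      also have "\<dots> \<le> K * R * ((4 * (real n)\<^sup>2) ^ N * G c)"
        unfolding R_def using n \<open>l \<le> N\<close> K0 G0 
        by (intro mult_mono mult_left_mono power_increasing e mult_nonneg_nonneg ultra_int_nonneg
            continuous_intros) auto
      also have "\<dots> = K * 4 ^ N * R\<^sup>2 * G c"
      proof -
        have "((real n)\<^sup>2) ^ N = R" by (simp add: R_def power_mult)
        then show ?thesis by (simp add: power_mult_distrib power2_eq_square)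
      qed
      finally show ?thesis .
    qed
    have "\<bar>ultra_int N (\<lambda>x. a x * sum_deriv n l c x * ultra_sum n 0 d x)\<bar>
        \<le> ultra_int N (\<lambda>x. (B / R) * (sum_deriv n l c x)\<^sup>2 + (B * R) * (ultra_sum n 0 d x)\<^sup>2)"
    proof (intro ultra_int_abs_le continuous_intros a)
      fix x :: real assume x: "x \<in> {-1..1}"
      define q where "q = sum_deriv n l c x"
      define p where "p = ultra_sum n 0 d x"
      have "0 \<le> (\<bar>q\<bar> - R * \<bar>p\<bar>)\<^sup>2 / R" using R by simp
      also have "\<dots> = q\<^sup>2 / R + R * p\<^sup>2 - 2 * \<bar>q * p\<bar>"
        using R by (simp add: power2_eq_square field_simps abs_mult)
      finally have "\<bar>q * p\<bar> \<le> q\<^sup>2 / R + R * p\<^sup>2" using abs_ge_zero[of "q * p"] by linarith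
      then have "\<bar>a x\<bar> * \<bar>q * p\<bar> \<le> B * (q\<^sup>2 / R + R * p\<^sup>2)"
        using B[OF x] B0 by (intro mult_mono) auto
      then show "\<bar>a x * q * p\<bar> \<le> (B / R) * q\<^sup>2 + (B * R) * p\<^sup>2"
        by (simp add: abs_mult algebra_simps)
    qed
    also have "\<dots> = (B / R) * ultra_int N (\<lambda>x. (sum_deriv n l c x)\<^sup>2) + (B * R) * G d"
      unfolding G_def by (intro ultra_int_lincomb continuous_intros)
    also have "\<dots> \<le> (B / R) * (K * 4 ^ N * R\<^sup>2 * G c) + (B * R) * G d"
      using B0 R by (intro add_right_mono mult_left_mono deriv) auto
    also have "\<dots> = B * R * (K * 4 ^ N * G c + G d)"
      using R by (simp add: power2_eq_square field_simps)
    also have "\<dots> \<le> B * R * ((K * 4 ^ N + 1) * (G c + G d))"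
      using B0 R G0[of c] G0[of d] K0 by (intro mult_left_mono) (auto simp: algebra_simps)
    finally show "\<bar>ultra_int N (\<lambda>x. a x * sum_deriv n l c x * ultra_sum n 0 d x)\<bar>
      \<le> B * (K * 4 ^ N + 1) * real n ^ (2 * N) * (cheb_norm2 N n c + cheb_norm2 N n d)"
      by (simp add: R_def G_def mult_ac)
  qed
qed

lemma op_form_bound:
  assumes a: "\<And>l. l \<le> N \<Longrightarrow> continuous_on {-1..1} (a l)"
  shows "\<exists>M. \<forall>n\<ge>1. \<forall>c d. \<bar>ultra_int N (\<lambda>x. (\<Sum>k<n. c k * operator_on_cheb N a k x)
      * ultra_sum n 0 d x)\<bar>
     \<le> M * real n ^ (2 * N) * (cheb_norm2 N n c + cheb_norm2 N n d)"
proof -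
  have "\<forall>l\<in>{..N}. \<exists>M. \<forall>n\<ge>1. \<forall>c d. \<bar>ultra_int N (\<lambda>x. a l x * sum_deriv n l c x * ultra_sum n 0 d x)\<bar>
     \<le> M * real n ^ (2 * N) * (cheb_norm2 N n c + cheb_norm2 N n d)"
    using deriv_term_bound[OF a] by (meson atMost_iff)
  from bchoice[OF this] obtain M where M: "\<forall>l\<in>{..N}. \<forall>n\<ge>1. \<forall>c d.
      \<bar>ultra_int N (\<lambda>x. a l x * sum_deriv n l c x * ultra_sum n 0 d x)\<bar>
      \<le> M l * real n ^ (2 * N) * (cheb_norm2 N n c + cheb_norm2 N n d)"
    ..
  show ?thesis
  proof (intro exI[of _ "\<Sum>l\<le>N. M l"] allI impI)
    fix n :: nat and c d assume n: "n \<ge> 1"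
    have "ultra_int N (\<lambda>x. (\<Sum>k<n. c k * operator_on_cheb N a k x) * ultra_sum n 0 d x) =
        (\<Sum>l\<le>N. ultra_int N (\<lambda>x. a l x * sum_deriv n l c x * ultra_sum n 0 d x))"
      unfolding sum_operator_on_cheb sum_distrib_right
      using a by (intro ultra_int_sum continuous_intros) auto
    also have "\<bar>\<dots>\<bar> \<le> (\<Sum>l\<le>N. \<bar>ultra_int N (\<lambda>x. a l x * sum_deriv n l c x * ultra_sum n 0 d x)\<bar>)"
      by (rule sum_abs)
    also have "\<dots> \<le> (\<Sum>l\<le>N. M l * real n ^ (2 * N) * (cheb_norm2 N n c + cheb_norm2 N n d))"
      using n M by (intro sum_mono) blast
    finally show "\<bar>ultra_int N (\<lambda>x. (\<Sum>k<n. c k * operator_on_cheb N a k x) * ultra_sum n 0 d x)\<bar>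
       \<le> (\<Sum>l\<le>N. M l) * real n ^ (2 * N) * (cheb_norm2 N n c + cheb_norm2 N n d)"
      by (simp add: sum_distrib_right)
  qed
qed

section \<open>The semi-discrete matrix as a Galerkin matrix\<close>

abbreviation vec_poly :: "nat \<Rightarrow> nat \<Rightarrow> real Matrix.vec \<Rightarrow> real \<Rightarrow> real" where
  "vec_poly n l v \<equiv> ultra_sum n l (vec_index v)"

text \<open>
  Truncation loses nothing here: \<open>conv_op l\<close> is upper triangular, so the coefficients with index at
  least \<open>n\<close> vanish before and after the conversion.
\<close>
lemma vec_poly_conv_inv:
  assumes z: "z \<in> carrier_vec n"
  shows "vec_poly n l (conv_inv_mat n l *\<^sub>v z) = vec_poly n (Suc l) z"
proof
  fix x
  define y where "y = conv_inv_mat n l *\<^sub>v z"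
  define c where "c k = (if k < n then vec_index y k else 0)" for k
  have y: "y \<in> carrier_vec n" using mult_mat_vec_carrier[OF conv_inv(1) z] by (simp add: y_def)
  have S: "section_mat n (conv_op l) \<in> carrier_mat n n" by (simp add: section_mat_def)
  have Sy: "section_mat n (conv_op l) *\<^sub>v y = z"
    unfolding y_def using assoc_mult_mat_vec[OF S conv_inv(1) z, of l] conv_inv(3)[of n l] z by simp
  have "vec_index z j = conv_seq l c j" if "j < n" for j
  proof -
    have "vec_index z j = (\<Sum>k<n. conv_op l j k * vec_index y k)"
      unfolding Sy[symmetric] using y that
      by (simp add: section_mat_def scalar_prod_def lessThan_atLeast0)
    also have "\<dots> = (\<Sum>k<n. conv_op l j k * c k)" by (simp add: c_def)
    also have "\<dots> = (\<Sum>k\<in>{j, j + 2}. conv_op l j k * c k)"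
      using that by (intro sum.mono_neutral_cong) (auto simp: c_def conv_op_def)
    finally show ?thesis by (simp add: conv_seq_def conv_op_band[of l j "Suc (Suc j)"])
  qed
  then have "vec_poly n (Suc l) z x = ultra_sum n (Suc l) (conv_seq l c) x"
    by (simp add: ultra_sum_def)
  also have "\<dots> = ultra_sum n l c x" by (rule ultra_sum_conv[symmetric]) (simp add: c_def)
  also have "\<dots> = vec_poly n l y x" by (simp add: ultra_sum_def c_def)
  finally show "vec_poly n l (conv_inv_mat n l *\<^sub>v z) x = vec_poly n (Suc l) z x" by (simp add: y_def)
qed

lemma conv_inv_chain_carrier:
  assumes "L \<in> carrier_mat n n"
  shows "foldr (*) (map (conv_inv_mat n) xs) L \<in> carrier_mat n n"
  by (induction xs) (auto intro: assms mult_carrier_mat conv_inv(1))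

lemma vec_poly_conv_inv_chain:
  assumes L: "L \<in> carrier_mat n n" and x: "x \<in> carrier_vec n" and "m \<le> N"
  shows "vec_poly n m (foldr (*) (map (conv_inv_mat n) [m..<N]) L *\<^sub>v x) = vec_poly n N (L *\<^sub>v x)"
  using \<open>m \<le> N\<close>
proof (induction m rule: inc_induct)
  case base
  then show ?case by simp
next
  case (step m)
  define F where "F = foldr (*) (map (conv_inv_mat n) [Suc m..<N]) L"
  have F: "F \<in> carrier_mat n n" unfolding F_def by (rule conv_inv_chain_carrier[OF L])
  have "foldr (*) (map (conv_inv_mat n) [m..<N]) L *\<^sub>v x = conv_inv_mat n m *\<^sub>v (F *\<^sub>v x)"
    using step.hyps by (simp add: upt_conv_Cons F_def[symmetric]
        assoc_mult_mat_vec[OF conv_inv(1) F x])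
  then show ?case using step.IH F x by (simp add: vec_poly_conv_inv F_def)
qed

lemma semidiscrete_carrier: "semidiscrete_mat n N a \<in> carrier_mat n n"
  unfolding semidiscrete_mat_def by (rule conv_inv_chain_carrier) (simp add: section_mat_def)

text \<open>
  Both polynomials on the left are written in the basis \<open>ultra N j\<close>, where the inverse conversions
  have disappeared and the coefficients of the first are those of the image of \<open>vec_poly n 0 v\<close> under
  the operator.
\<close>
lemma semidiscrete_galerkin:
  assumes a: "\<And>l. l \<le> N \<Longrightarrow> continuous_on {-1..1} (a l)" and v: "v \<in> carrier_vec n"
  shows "ultra_int N (\<lambda>x. vec_poly n 0 (semidiscrete_mat n N a *\<^sub>v v) x * ultra_sum n 0 d x) =
     ultra_int N (\<lambda>x. (\<Sum>k<n. vec_index v k * operator_on_cheb N a k x) * ultra_sum n 0 d x)"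
proof -
  let ?L = "section_mat n (ultra_rep N a)"
  let ?f = "\<lambda>x. \<Sum>k<n. vec_index v k * operator_on_cheb N a k x"
  obtain e where e: "ultra_sum n 0 d = ultra_sum n N e" using ultra_sum_raise by blast
  have f: "continuous_on {-1..1} ?f"
    by (intro continuous_intros continuous_operator_on_cheb a)
  have Lv: "vec_index (?L *\<^sub>v v) j = ultra_coeff N ?f j" if "j < n" for j
  proof -
    have "vec_index (?L *\<^sub>v v) j = (\<Sum>k<n. ultra_rep N a j k * vec_index v k)"
      using v that by (simp add: section_mat_def scalar_prod_def lessThan_atLeast0)
    also have "\<dots> = (\<Sum>k<n. ultra_coeff N (\<lambda>x. vec_index v k * operator_on_cheb N a k x) j)"
      using a by (simp add: ultra_rep_eq ultra_coeff_cmult continuous_operator_on_cheb mult.commute)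
    also have "\<dots> = ultra_coeff N ?f j"
      by (intro ultra_coeff_sum[symmetric] continuous_intros continuous_operator_on_cheb a) auto
    finally show ?thesis .
  qed
  have "vec_poly n 0 (semidiscrete_mat n N a *\<^sub>v v) = vec_poly n N (?L *\<^sub>v v)"
    unfolding semidiscrete_mat_def
    by (rule vec_poly_conv_inv_chain) (use v in \<open>auto simp: section_mat_def\<close>)
  then have "ultra_int N (\<lambda>x. vec_poly n 0 (semidiscrete_mat n N a *\<^sub>v v) x * ultra_sum n 0 d x) =
      (\<Sum>j<n. ultra_coeff N ?f j * e j * ultra_norm2 N j)"
    unfolding e by (simp add: ultra_sum_parseval Lv)
  also have "\<dots> = (\<Sum>j<n. e j * ultra_int N (\<lambda>x. ?f x * ultra N j x))"
  proof (intro sum.cong refl)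
    fix j
    show "ultra_coeff N ?f j * e j * ultra_norm2 N j = e j * ultra_int N (\<lambda>x. ?f x * ultra N j x)"
      using ultra_norm2_pos[of N j] by (simp add: ultra_coeff_eq[OF f])
  qed
  also have "\<dots> = ultra_int N (\<lambda>x. ?f x * ultra_sum n N e x)"
    by (rule ultra_int_mult_ultra_sum[OF f, symmetric])
  finally show ?thesis unfolding e .
qed

section \<open>The spectral radius\<close>

text \<open>
  For an eigenvector \<open>x + \<i> y\<close> with eigenvalue \<open>\<mu>\<close>, the real vectors \<open>x\<close> and \<open>y\<close> span an invariant subspace,
  and the energy \<open>E = g x x + g y y\<close> satisfies \<open>Re \<mu> * E = g (A x) x + g (A y) y\<close> and
  \<open>Im \<mu> * E = g (A y) x - g (A x) y\<close>.
\<close>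
lemma spectral_radius_le_of_form:
  fixes A :: "real Matrix.mat" and g :: "real Matrix.vec \<Rightarrow> real Matrix.vec \<Rightarrow> real"
  assumes A: "A \<in> carrier_mat n n" and n: "n > 0"
    and lin: "\<And>x y z p q. x \<in> carrier_vec n \<Longrightarrow> y \<in> carrier_vec n \<Longrightarrow> z \<in> carrier_vec n \<Longrightarrow>
        g (p \<cdot>\<^sub>v x + q \<cdot>\<^sub>v y) z = p * g x z + q * g y z"
    and sym: "\<And>x y. x \<in> carrier_vec n \<Longrightarrow> y \<in> carrier_vec n \<Longrightarrow> g x y = g y x"
    and pos: "\<And>x. x \<in> carrier_vec n \<Longrightarrow> x \<noteq> 0\<^sub>v n \<Longrightarrow> g x x > 0"
    and bound: "\<And>x y. x \<in> carrier_vec n \<Longrightarrow> y \<in> carrier_vec n \<Longrightarrow>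
        \<bar>g (A *\<^sub>v x) y\<bar> \<le> M * (g x x + g y y)"
  shows "spectral_radius (map_mat complex_of_real A) \<le> 4 * M"
proof -
  let ?A = "map_mat complex_of_real A"
  have cA: "?A \<in> carrier_mat n n" using A by simp
  obtain ev where ev: "ev \<in> spectrum ?A" and rho: "spectral_radius ?A = norm ev"
    using spectral_radius_mem_max(1)[OF cA n] by auto
  then obtain v where "eigenvector ?A v ev" by (auto simp: spectrum_def eigenvalue_def)
  then have v: "v \<in> carrier_vec n" "v \<noteq> 0\<^sub>v n" and Av: "?A *\<^sub>v v = ev \<cdot>\<^sub>v v"
    using A by (auto simp: eigenvector_def)
  define x where "x = map_vec Re v"
  define y where "y = map_vec Im v"
  have x: "x \<in> carrier_vec n" and y: "y \<in> carrier_vec n" using v by (auto simp: x_def y_def)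
  have row: "(\<Sum>k<n. complex_of_real (A $$ (i, k)) * vec_index v k)
      = ev * vec_index v i" if "i < n" for i
  proof -
    have "vec_index (?A *\<^sub>v v) i = vec_index (ev \<cdot>\<^sub>v v) i" by (simp add: Av)
    then show ?thesis using that A v by (simp add: scalar_prod_def lessThan_atLeast0)
  qed
  have Ax: "A *\<^sub>v x = Re ev \<cdot>\<^sub>v x + (- Im ev) \<cdot>\<^sub>v y"
  proof (rule eq_vecI)
    fix i assume "i < dim_vec (Re ev \<cdot>\<^sub>v x + (- Im ev) \<cdot>\<^sub>v y)"
    then have i: "i < n" using y by simp
    then show "vec_index (A *\<^sub>v x) i = vec_index (Re ev \<cdot>\<^sub>v x + (- Im ev) \<cdot>\<^sub>v y) i"
      using arg_cong[OF row[OF i], of Re] A v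
      by (simp add: scalar_prod_def lessThan_atLeast0 x_def y_def)
  qed (use A y in auto)
  have Ay: "A *\<^sub>v y = Im ev \<cdot>\<^sub>v x + Re ev \<cdot>\<^sub>v y"
  proof (rule eq_vecI)
    fix i assume "i < dim_vec (Im ev \<cdot>\<^sub>v x + Re ev \<cdot>\<^sub>v y)"
    then have i: "i < n" using y by simp
    then show "vec_index (A *\<^sub>v y) i = vec_index (Im ev \<cdot>\<^sub>v x + Re ev \<cdot>\<^sub>v y) i"
      using arg_cong[OF row[OF i], of Im] A v
      by (simp add: scalar_prod_def lessThan_atLeast0 x_def y_def add.commute)
  qed (use A y in auto)
  define E where "E = g x x + g y y"
  have ge0: "g z z \<ge> 0" if "z \<in> carrier_vec n" for z
  proof (cases "z = 0\<^sub>v n")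
    case True
    have "g (0 \<cdot>\<^sub>v z + 0 \<cdot>\<^sub>v z) z = 0" using lin[OF that that that, of 0 0] by simp
    moreover have "0 \<cdot>\<^sub>v z + 0 \<cdot>\<^sub>v z = z" using True by (intro eq_vecI) auto
    ultimately show ?thesis by simp
  next
    case False
    then show ?thesis using pos[OF that] by simp
  qed
  have "x \<noteq> 0\<^sub>v n \<or> y \<noteq> 0\<^sub>v n"
  proof (rule ccontr)
    assume "\<not> ?thesis"
    then have "map_vec Re v = 0\<^sub>v n" "map_vec Im v = 0\<^sub>v n" by (auto simp: x_def y_def)
    then have "Re (vec_index v i) = 0 \<and> Im (vec_index v i) = 0" if "i < n" for i
      using v that by (metis carrier_vecD index_map_vec(1) index_zero_vec(1))
    then have "v = 0\<^sub>v n" using v by (intro eq_vecI) (auto simp: complex_eq_iff)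
    with v show False by simp
  qed
  then have E: "E > 0" using pos[OF x] pos[OF y] ge0[OF x] ge0[OF y]
    by (auto simp: E_def add_pos_nonneg add_nonneg_pos)
  have "Re ev * E = g (A *\<^sub>v x) x + g (A *\<^sub>v y) y"
    unfolding Ax Ay using x y by (simp add: lin sym[OF y x] E_def algebra_simps)
  also have "\<bar>\<dots>\<bar> \<le> M * (g x x + g x x) + M * (g y y + g y y)"
    using bound[OF x x] bound[OF y y] by linarith
  finally have "\<bar>Re ev\<bar> * E \<le> 2 * M * E" using E by (simp add: E_def abs_mult algebra_simps)
  then have re: "\<bar>Re ev\<bar> \<le> 2 * M" using E by simp
  have "Im ev * E = g (A *\<^sub>v y) x - g (A *\<^sub>v x) y"
    unfolding Ax Ay using x y by (simp add: lin sym[OF y x] E_def algebra_simps)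
  also have "\<bar>\<dots>\<bar> \<le> M * (g y y + g x x) + M * (g x x + g y y)"
    using bound[OF x y] bound[OF y x] by linarith
  finally have "\<bar>Im ev\<bar> * E \<le> 2 * M * E" using E by (simp add: E_def abs_mult algebra_simps)
  then have im: "\<bar>Im ev\<bar> \<le> 2 * M" using E by simp
  show ?thesis using re im cmod_le[of ev] rho by linarith
qed

lemma smooth_on_I_continuous: "smooth_on_I f \<Longrightarrow> continuous_on {-1..1} f"
  unfolding smooth_on_I_def by (metis DERIV_continuous_on)

theorem theorem3p3:
  fixes N :: nat and a :: "nat \<Rightarrow> real \<Rightarrow> real"
  assumes "N \<ge> 1"
    and "\<And>l. l \<le> N \<Longrightarrow> smooth_on_I (a l)"
    and "\<And>x. x \<in> {-1..1} \<Longrightarrow> a N x \<noteq> 0"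
  shows "\<exists>C::real. \<forall>n::nat. n \<ge> 1 \<longrightarrow>
    spectral_radius (map_mat complex_of_real (semidiscrete_mat n N a)) \<le> C * real n ^ (2 * N)"
proof -
  have a: "\<And>l. l \<le> N \<Longrightarrow> continuous_on {-1..1} (a l)"
    using assms(2) by (rule smooth_on_I_continuous)
  obtain M where M: "\<And>n c d. n \<ge> 1 \<Longrightarrow> \<bar>ultra_int N
      (\<lambda>x. (\<Sum>k<n. c k * operator_on_cheb N a k x) * ultra_sum n 0 d x)\<bar>
     \<le> M * real n ^ (2 * N) * (cheb_norm2 N n c + cheb_norm2 N n d)"
    using op_form_bound[of N a, OF a] by blast
  show ?thesis
  proof (intro exI[of _ "4 * M"] allI impI)
    fix n :: nat assume n: "n \<ge> 1"
    define g where "g x y = ultra_int N (\<lambda>t. vec_poly n 0 x t * vec_poly n 0 y t)" for x y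
    have gsq: "g x x = ultra_int N (\<lambda>t. (vec_poly n 0 x t)\<^sup>2)" for x
      by (simp add: g_def power2_eq_square)
    have "spectral_radius (map_mat complex_of_real (semidiscrete_mat n N a))
        \<le> 4 * (M * real n ^ (2 * N))"
    proof (rule spectral_radius_le_of_form[where g = g, OF semidiscrete_carrier])
      show "n > 0" using n by simp
      fix x y :: "real Matrix.vec" assume x: "x \<in> carrier_vec n" and y: "y \<in> carrier_vec n"
      show "g x y = g y x" by (simp add: g_def mult.commute)
      show "\<bar>g (semidiscrete_mat n N a *\<^sub>v x) y\<bar> \<le> M * real n ^ (2 * N) * (g x x + g y y)"
      proof -
        have "g (semidiscrete_mat n N a *\<^sub>v x) y =
            ultra_int N (\<lambda>t. (\<Sum>k<n. vec_index x k * operator_on_cheb N a k t) * vec_poly n 0 y t)"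
          unfolding g_def by (rule semidiscrete_galerkin[OF a x])
        then show ?thesis unfolding gsq using M[OF n] by simp
      qed
      fix z :: "real Matrix.vec" and p q assume z: "z \<in> carrier_vec n"
      have "vec_poly n 0 (p \<cdot>\<^sub>v x + q \<cdot>\<^sub>v y) t = p * vec_poly n 0 x t + q * vec_poly n 0 y t" for t
      proof -
        have "vec_poly n 0 (p \<cdot>\<^sub>v x + q \<cdot>\<^sub>v y) t
            = (\<Sum>k<n. p * (vec_index x k * ultra 0 k t) + q * (vec_index y k * ultra 0 k t))"
          unfolding ultra_sum_def using x y by (intro sum.cong) (auto simp: algebra_simps)
        then show ?thesis by (simp add: ultra_sum_def sum.distrib sum_distrib_left)
      qed
      then have "g (p \<cdot>\<^sub>v x + q \<cdot>\<^sub>v y) z = ultra_int N (\<lambda>t. p * (vec_poly n 0 x t * vec_poly n 0 z t)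
          + q * (vec_poly n 0 y t * vec_poly n 0 z t))"
        by (simp add: g_def algebra_simps)
      also have "\<dots> = p * g x z + q * g y z"
        unfolding g_def by (intro ultra_int_lincomb continuous_intros)
      finally show "g (p \<cdot>\<^sub>v x + q \<cdot>\<^sub>v y) z = p * g x z + q * g y z" .
    next
      fix x :: "real Matrix.vec" assume x: "x \<in> carrier_vec n" "x \<noteq> 0\<^sub>v n"
      then obtain i where i: "i < n" "vec_index x i \<noteq> 0"
        by (metis carrier_vecD eq_vecI index_zero_vec)
      have "0 < (\<Sum>k<n. (vec_index x k)\<^sup>2 * ultra_norm2 0 k)"
        using i ultra_norm2_pos[of 0] by (intro sum_pos2[of _ i]) (auto simp: less_imp_le)
      also have "\<dots> = ultra_int 0 (\<lambda>t. (vec_poly n 0 x t)\<^sup>2)" by (simp add: ultra_sum_parseval_square)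
      also have "\<dots> \<le> (4 * (real n)\<^sup>2) ^ N * g x x" unfolding gsq using ultra_sum_raise by blast
      finally show "0 < g x x" by (rule zero_less_mult_pos) (use n in simp)
    qed
    then show "spectral_radius (map_mat complex_of_real (semidiscrete_mat n N a))
        \<le> 4 * M * real n ^ (2 * N)"
      by simp
  qed
qed

end
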